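(* Let $M$ be a complex manifold and $G$ a complex Lie group with Lie algebra $\mathfrak{g}$. Let $\omega_1,\omega_2 \in \Omega^{(0,1)}(M,\mathfrak{g})$ satisfy $\bar\partial\omega_k + \tfrac12[\omega_k,\omega_k]=0$ for $k=1,2$, and let $P_1$ and $P_2$ be the corresponding smoothly trivial holomorphic principal $G$-bundles over $M$, i.e. $P_k = M\times G$ with the complex structure $I_{\omega_k}$. Then $P_1$ and $P_2$ are holomorphically equivalent if and only if there is a smooth map $f \in C^\infty(M,G)$ such that $$\omega_1 = f^{-1}.\bar\partial f + \mathrm{Ad}(f)^{-1}.\omega_2 .$$
   Context: A $\mathfrak g$-valued 1-form $\omega$ is of type $(0,1)$ if $\omega(iv)=-i\,\omega(v)$; $\Omega^{(0,1)}(M,\mathfrak g)$ is the space of smooth such forms. The operator $\bar\partial$ is the $(p,q+1)$-component of the de Rham differential on $(p,q)$-forms, and $[\alpha,\beta](X,Y) = [\alpha(X),\beta(Y)]-[\alpha(Y),\beta(X)]$ for $\mathfrak g$-valued 1-forms. For $\omega\in\Omega^{(0,1)}(M,\mathfrak g)$, $I_\omega$ is the almost complex structure on $M\times G$ given by $I_\omega(v,w) = (iv,\, iw+2i\,\omega_x(v).g)$ for $(v,w)\in T_xM\oplus T_gG$, where $\xi.g\in T_gG$ denotes the right translate of $\xi\in\mathfrak g$ by $g$. It is integrable when $\bar\partial\omega+\frac12[\omega,\omega]=0$, and then $M\times G$ with the complex structure $I_\omega$, the projection to $M$ and the right $G$-action $(x,h)g=(x,hg)$ is a holomorphic principal $G$-bundle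 over $M$. Two holomorphic principal $G$-bundles over $M$ are holomorphically equivalent if there is a biholomorphic $G$-equivariant bundle map between them covering the identity of $M$. For $f\in C^\infty(M,G)$, the $\mathfrak g$-valued 1-form $f^{-1}.df$, $(f^{-1}.df)_x = d\lambda_{f(x)^{-1}}\circ df_x$ (with $\lambda_g$ left translation by $g$), decomposes uniquely as $f^{-1}.\partial f+f^{-1}.\bar\partial f$ with $f^{-1}.\partial f$ of type $(1,0)$ and $f^{-1}.\bar\partial f$ of type $(0,1)$. The form $\mathrm{Ad}(f)^{-1}.\omega$ is given pointwise by $v\mapsto \mathrm{Ad}(f(x))^{-1}\omega_x(v)$. *)

theory Defs
  imports
    "HOL-Analysis.Analysis"
    "HOL-Algebra.Group"
    "HOL-Library.Function_Algebras"
begin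

class scaleC =
  fixes scaleC :: "complex \<Rightarrow> 'a \<Rightarrow> 'a"  (infixr "*\<^sub>C" 75)

text \<open>Finite-dimensional complex normed spaces. Compared with \<^typ>\<open>complex ^ 'n\<close>, the class is
  closed under binary products and does not exclude dimension 0.\<close>

class complex_fd_space = real_normed_vector + scaleC +
  assumes scaleC_add_right: "a *\<^sub>C (x + y) = a *\<^sub>C x + a *\<^sub>C y"
    and scaleC_add_left: "(a + b) *\<^sub>C x = a *\<^sub>C x + b *\<^sub>C x"
    and scaleC_scaleC: "a *\<^sub>C (b *\<^sub>C x) = (a * b) *\<^sub>C x"
    and scaleC_of_real: "complex_of_real r *\<^sub>C x = r *\<^sub>R x"
    and norm_scaleC: "norm (a *\<^sub>C x) = cmod a * norm x"
    and finite_spanning: "\<exists>B. finite B \<and> (\<forall>x. \<exists>c. x = (\<Sum>b\<in>B. c b *\<^sub>C b))"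

lemma scaleC_one [simp]: "1 *\<^sub>C x = (x::'a::complex_fd_space)"
  using scaleC_of_real[of 1 x] by simp

lemma scaleC_zero_left [simp]: "0 *\<^sub>C (x::'a::complex_fd_space) = 0"
  using scaleC_of_real[of 0 x] by simp

lemma scaleC_zero_right [simp]: "a *\<^sub>C (0::'a::complex_fd_space) = 0"
  using scaleC_add_right[of a 0 0] by simp

lemma scaleC_minus_right: "a *\<^sub>C (- x :: 'a::complex_fd_space) = - (a *\<^sub>C x)"
  using scaleC_add_right[of a x "- x"] by (simp add: eq_neg_iff_add_eq_0 add.commute)

lemma scaleC_minus_left: "(- a) *\<^sub>C (x::'a::complex_fd_space) = - (a *\<^sub>C x)"
  using scaleC_add_left[of a "- a" x] by (simp add: eq_neg_iff_add_eq_0 add.commute)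

lemma scaleC_diff_right: "a *\<^sub>C (x - y :: 'a::complex_fd_space) = a *\<^sub>C x - a *\<^sub>C y"
  using scaleC_add_right[of a x "- y"] by (simp add: scaleC_minus_right)

instantiation complex :: complex_fd_space
begin

definition scaleC_complex :: "complex \<Rightarrow> complex \<Rightarrow> complex" where
  "scaleC_complex = (*)"

instance
proof
  show "\<exists>B. finite B \<and> (\<forall>x::complex. \<exists>c. x = (\<Sum>b\<in>B. c b *\<^sub>C b))"
    by (rule exI[of _ "{1}"]) (auto simp: scaleC_complex_def)
qed (auto simp: scaleC_complex_def algebra_simps norm_mult scaleR_conv_of_real)

end

instantiation prod :: (complex_fd_space, complex_fd_space) complex_fd_space
begin

definition scaleC_prod :: "complex \<Rightarrow> 'a \<times> 'b \<Rightarrow> 'a \<times> 'b" where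
  "scaleC_prod a p = (a *\<^sub>C fst p, a *\<^sub>C snd p)"

instance
proof
  fix a :: complex and x :: "'a \<times> 'b"
  have "norm (a *\<^sub>C x) = sqrt ((cmod a)\<^sup>2 * ((norm (fst x))\<^sup>2 + (norm (snd x))\<^sup>2))"
    by (simp add: scaleC_prod_def norm_prod_def norm_scaleC power_mult_distrib algebra_simps)
  then show "norm (a *\<^sub>C x) = cmod a * norm x"
    by (simp add: real_sqrt_mult norm_prod_def)
next
  obtain A :: "'a set" where A: "finite A" "\<forall>x. \<exists>c. x = (\<Sum>b\<in>A. c b *\<^sub>C b)"
    using finite_spanning by blast
  obtain B :: "'b set" where B: "finite B" "\<forall>x. \<exists>c. x = (\<Sum>b\<in>B. c b *\<^sub>C b)"
    using finite_spanning by blast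
  let ?S = "(\<lambda>a. (a, 0::'b)) ` (A - {0}) \<union> (\<lambda>b. (0::'a, b)) ` B"
  have "\<exists>c. p = (\<Sum>s\<in>?S. c s *\<^sub>C s)" for p :: "'a \<times> 'b"
  proof -
    obtain c where c: "fst p = (\<Sum>b\<in>A. c b *\<^sub>C b)" using A by blast
    obtain d where d: "snd p = (\<Sum>b\<in>B. d b *\<^sub>C b)" using B by blast
    let ?e = "\<lambda>s. if fst s = 0 then d (snd s) else c (fst s)"
    have "(\<Sum>s\<in>?S. ?e s *\<^sub>C s) =
        (\<Sum>s\<in>(\<lambda>a. (a, 0)) ` (A - {0}). ?e s *\<^sub>C s) + (\<Sum>s\<in>(\<lambda>b. (0, b)) ` B. ?e s *\<^sub>C s)"
      using A B by (intro sum.union_disjoint) auto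
    also have "(\<Sum>s\<in>(\<lambda>a. (a, 0::'b)) ` (A - {0}). ?e s *\<^sub>C s) = (\<Sum>a\<in>A - {0}. (c a *\<^sub>C a, 0))"
      by (subst sum.reindex) (auto simp: inj_on_def scaleC_prod_def intro!: sum.cong)
    also have "(\<Sum>a\<in>A - {0}. (c a *\<^sub>C a, 0::'b)) = (\<Sum>a\<in>A. (c a *\<^sub>C a, 0))"
      using A by (intro sum.mono_neutral_left) (auto simp: zero_prod_def)
    also have "(\<Sum>s\<in>(\<lambda>b. (0::'a, b)) ` B. ?e s *\<^sub>C s) = (\<Sum>b\<in>B. (0, d b *\<^sub>C b))"
      by (subst sum.reindex) (auto simp: inj_on_def scaleC_prod_def intro!: sum.cong)
    also have "(\<Sum>a\<in>A. (c a *\<^sub>C a, 0::'b)) + (\<Sum>b\<in>B. (0::'a, d b *\<^sub>C b)) = p"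
      by (simp add: prod_eq_iff fst_sum snd_sum c d)
    finally show ?thesis by (intro exI[of _ ?e]) (rule sym)
  qed
  moreover have "finite ?S" using A B by simp
  ultimately show "\<exists>S. finite S \<and> (\<forall>p::'a \<times> 'b. \<exists>c. p = (\<Sum>s\<in>S. c s *\<^sub>C s))" by blast
qed (auto simp: scaleC_prod_def scaleC_add_right scaleC_add_left scaleC_scaleC scaleC_of_real
    scaleR_prod_def)

end

instantiation vec :: (complex_fd_space, finite) complex_fd_space
begin

definition scaleC_vec :: "complex \<Rightarrow> 'a ^ 'b \<Rightarrow> 'a ^ 'b" where
  "scaleC_vec a x = (\<chi> i. a *\<^sub>C x $ i)"

instance
proof
  fix a :: complex and x :: "'a ^ 'b"
  show "norm (a *\<^sub>C x) = cmod a * norm x"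
    by (simp add: scaleC_vec_def norm_vec_def norm_scaleC L2_set_right_distrib)
next
  obtain A :: "'a set" where A: "finite A" "\<forall>x. \<exists>c. x = (\<Sum>b\<in>A. c b *\<^sub>C b)"
    using finite_spanning by blast
  let ?h = "\<lambda>(i, b). axis i b :: 'a ^ 'b"
  let ?I = "(UNIV :: 'b set) \<times> (A - {0})"
  have inj: "inj_on ?h ?I" by (auto simp: inj_on_def axis_eq_axis)
  have "\<exists>c. x = (\<Sum>s\<in>?h ` ?I. c s *\<^sub>C s)" for x :: "'a ^ 'b"
  proof -
    have "\<forall>i. \<exists>c. x $ i = (\<Sum>b\<in>A. c b *\<^sub>C b)" using A by blast
    then obtain c where c: "\<And>i. x $ i = (\<Sum>b\<in>A. c i b *\<^sub>C b)" by metis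
    let ?e = "\<lambda>s. case the_inv_into ?I ?h s of (i, b) \<Rightarrow> c i b"
    have "(\<Sum>s\<in>?h ` ?I. ?e s *\<^sub>C s) = (\<Sum>p\<in>?I. ?e (?h p) *\<^sub>C ?h p)"
      by (subst sum.reindex[OF inj]) simp
    also have "\<dots> = (\<Sum>(i, b)\<in>?I. c i b *\<^sub>C axis i b)"
      using the_inv_into_f_f[OF inj] by (intro sum.cong) auto
    also have "\<dots> = (\<Sum>i\<in>UNIV. \<Sum>b\<in>A - {0}. c i b *\<^sub>C axis i b)"
      by (simp add: sum.cartesian_product)
    also have "\<dots> = x"
    proof (rule vec_eq_iff[THEN iffD2, rule_format])
      fix j
      have "(\<Sum>i\<in>UNIV. \<Sum>b\<in>A - {0}. c i b *\<^sub>C axis i b) $ j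
          = (\<Sum>i\<in>UNIV. if i = j then \<Sum>b\<in>A - {0}. c i b *\<^sub>C b else 0)"
        unfolding sum_component by (rule sum.cong) (auto simp: scaleC_vec_def axis_def)
      also have "\<dots> = (\<Sum>b\<in>A - {0}. c j b *\<^sub>C b)" by simp
      also have "\<dots> = (\<Sum>b\<in>A. c j b *\<^sub>C b)"
        using A by (intro sum.mono_neutral_left) auto
      finally show "(\<Sum>i\<in>UNIV. \<Sum>b\<in>A - {0}. c i b *\<^sub>C axis i b) $ j = x $ j"
        using c by simp
    qed
    finally show ?thesis by (intro exI[of _ ?e]) (rule sym)
  qed
  moreover have "finite (?h ` ?I)" using A by simp
  ultimately show "\<exists>S. finite S \<and> (\<forall>x::'a ^ 'b. \<exists>c. x = (\<Sum>s\<in>S. c s *\<^sub>C s))" by blast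
qed (auto simp: scaleC_vec_def vec_eq_iff scaleC_add_right scaleC_add_left scaleC_scaleC scaleC_of_real)

end

instantiation "fun" :: (type, scaleC) scaleC
begin

definition scaleC_fun :: "complex \<Rightarrow> ('a \<Rightarrow> 'b) \<Rightarrow> 'a \<Rightarrow> 'b" where
  "scaleC_fun a f = (\<lambda>x. a *\<^sub>C f x)"

instance ..

end

primrec cont_diff_on ::
  "nat \<Rightarrow> 'a::real_normed_vector set \<Rightarrow> ('a \<Rightarrow> 'b::real_normed_vector) \<Rightarrow> bool" where
  "cont_diff_on 0 S f \<longleftrightarrow> continuous_on S f"
| "cont_diff_on (Suc k) S f \<longleftrightarrow> (\<forall>x\<in>S. f differentiable (at x)) \<and>
     (\<forall>v. cont_diff_on k S (\<lambda>x. frechet_derivative f (at x) v))"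

text \<open>For open \<open>S\<close> in a finite-dimensional space this is the usual notion \<open>C\<^sup>\<infinity>\<close>, over the reals.\<close>

definition smooth_on :: "'a::real_normed_vector set \<Rightarrow> ('a \<Rightarrow> 'b::real_normed_vector) \<Rightarrow> bool" where
  "smooth_on S f \<longleftrightarrow> (\<forall>k. cont_diff_on k S f)"

text \<open>By Cauchy's integral formula, \<open>C\<^sup>\<infinity>\<close> with complex linear derivative is the same as complex
  differentiable; this form also makes sense for almost complex structures.\<close>

definition holo_on :: "'a::complex_fd_space set \<Rightarrow> ('a \<Rightarrow> 'b::complex_fd_space) \<Rightarrow> bool" where
  "holo_on S f \<longleftrightarrow> smooth_on S f \<and>
     (\<forall>x\<in>S. \<forall>v. frechet_derivative f (at x) (\<i> *\<^sub>C v) = \<i> *\<^sub>C frechet_derivative f (at x) v)"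

type_synonym ('a, 'v) chart = "'a set \<times> ('a \<Rightarrow> 'v)"

record ('a, 'v) manifold =
  mtop :: "'a topology"
  atlas :: "('a, 'v) chart set"

abbreviation points :: "('a, 'v) manifold \<Rightarrow> 'a set" where
  "points M \<equiv> topspace (mtop M)"

definition is_chart :: "'a topology \<Rightarrow> ('a, 'v::real_normed_vector) chart \<Rightarrow> bool" where
  "is_chart T c \<longleftrightarrow> openin T (fst c) \<and> open (snd c ` fst c) \<and>
     homeomorphic_map (subtopology T (fst c)) (top_of_set (snd c ` fst c)) (snd c)"

definition charts_at :: "('a, 'v) manifold \<Rightarrow> 'a \<Rightarrow> ('a, 'v) chart set" where
  "charts_at M x = {c \<in> atlas M. x \<in> fst c}"

definition chart_inv :: "('a, 'v) chart \<Rightarrow> 'v \<Rightarrow> 'a" where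
  "chart_inv c = inv_into (fst c) (snd c)"

definition local_rep :: "('a, 'v) chart \<Rightarrow> ('b, 'w) chart \<Rightarrow> ('a \<Rightarrow> 'b) \<Rightarrow> 'v \<Rightarrow> 'w" where
  "local_rep c d f = snd d \<circ> f \<circ> chart_inv c"

text \<open>Second countability is not required, and the atlas need not be maximal.\<close>

definition complex_manifold :: "('a, 'v::complex_fd_space) manifold \<Rightarrow> bool" where
  "complex_manifold M \<longleftrightarrow>
     Hausdorff_space (mtop M) \<and>
     (\<forall>c\<in>atlas M. is_chart (mtop M) c) \<and>
     (\<Union>c\<in>atlas M. fst c) = points M \<and>
     (\<forall>c\<in>atlas M. \<forall>d\<in>atlas M. holo_on (snd c ` (fst c \<inter> fst d)) (local_rep c d id))"

text \<open>A tangent vector at \<open>x\<close> is the family of its coordinates in all charts around \<open>x\<close>, related by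
  the derivatives of the transition maps. The coordinate 0 in all other indices makes equality of
  tangent vectors coincide with equality of functions. The vector space operations are those of
  functions, and multiplication by \<open>\<i>\<close> is intrinsic because transition maps are holomorphic.\<close>

type_synonym ('a, 'v) tvec = "('a, 'v) chart \<Rightarrow> 'v"

definition tangent :: "('a, 'v::real_normed_vector) manifold \<Rightarrow> 'a \<Rightarrow> ('a, 'v) tvec set" where
  "tangent M x = {v.
     (\<forall>c. c \<notin> charts_at M x \<longrightarrow> v c = 0) \<and>
     (\<forall>c\<in>charts_at M x. \<forall>d\<in>charts_at M x.
        v d = frechet_derivative (local_rep c d id) (at (snd c x)) (v c))}"

text \<open>The tangent vector at \<open>x\<close> with coordinates \<open>w\<close> in the chart \<open>c\<close>.\<close>

definition coord_vec ::
  "('a, 'v::real_normed_vector) manifold \<Rightarrow> ('a, 'v) chart \<Rightarrow> 'a \<Rightarrow> 'v \<Rightarrow> ('a, 'v) tvec" where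
  "coord_vec M c x w = (\<lambda>d. if d \<in> charts_at M x
     then frechet_derivative (local_rep c d id) (at (snd c x)) w else 0)"

definition smooth_map :: "('a, 'v::real_normed_vector) manifold \<Rightarrow>
    ('b, 'w::real_normed_vector) manifold \<Rightarrow> ('a \<Rightarrow> 'b) \<Rightarrow> bool" where
  "smooth_map M N f \<longleftrightarrow> continuous_map (mtop M) (mtop N) f \<and>
     (\<forall>c\<in>atlas M. \<forall>d\<in>atlas N. smooth_on (snd c ` (fst c \<inter> f -` fst d)) (local_rep c d f))"

text \<open>The differential of \<open>f\<close> at \<open>x\<close>. For smooth \<open>f\<close> the choice of the chart around \<open>x\<close> is
  immaterial.\<close>

definition tderiv :: "('a, 'v::real_normed_vector) manifold \<Rightarrow>
    ('b, 'w::real_normed_vector) manifold \<Rightarrow> ('a \<Rightarrow> 'b) \<Rightarrow> 'a \<Rightarrow> ('a, 'v) tvec \<Rightarrow> ('b, 'w) tvec" where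
  "tderiv M N f x v = (let c = (SOME c. c \<in> charts_at M x) in
     (\<lambda>d. if d \<in> charts_at N (f x)
       then frechet_derivative (local_rep c d f) (at (snd c x)) (v c) else 0))"

definition holo_map :: "('a, 'v::complex_fd_space) manifold \<Rightarrow>
    ('b, 'w::complex_fd_space) manifold \<Rightarrow> ('a \<Rightarrow> 'b) \<Rightarrow> bool" where
  "holo_map M N f \<longleftrightarrow> smooth_map M N f \<and>
     (\<forall>x\<in>points M. \<forall>v\<in>tangent M x. tderiv M N f x (\<i> *\<^sub>C v) = \<i> *\<^sub>C tderiv M N f x v)"

definition prod_mfd :: "('a, 'v) manifold \<Rightarrow> ('b, 'w) manifold \<Rightarrow> ('a \<times> 'b, 'v \<times> 'w) manifold" where
  "prod_mfd M N = \<lparr>mtop = prod_topology (mtop M) (mtop N),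
     atlas = {(fst c \<times> fst d, map_prod (snd c) (snd d)) | c d. c \<in> atlas M \<and> d \<in> atlas N}\<rparr>"

text \<open>The identification of \<open>T\<^sub>xM \<oplus> T\<^sub>yN\<close> with the tangent space of the product at \<open>(x, y)\<close>;
  its inverse is given by the differentials of the two projections.\<close>

definition tpair :: "('a, 'v::real_normed_vector) manifold \<Rightarrow> ('b, 'w::real_normed_vector) manifold \<Rightarrow>
    'a \<times> 'b \<Rightarrow> ('a, 'v) tvec \<Rightarrow> ('b, 'w) tvec \<Rightarrow> ('a \<times> 'b, 'v \<times> 'w) tvec" where
  "tpair M N p v w =
     tderiv M (prod_mfd M N) (\<lambda>x. (x, snd p)) (fst p) v +
     tderiv N (prod_mfd M N) (\<lambda>y. (fst p, y)) (snd p) w"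

record ('g, 'n) lie_group = "'g monoid" +
  mfd :: "('g, 'n) manifold"

definition complex_lie_group :: "('g, 'n::complex_fd_space) lie_group \<Rightarrow> bool" where
  "complex_lie_group G \<longleftrightarrow> group G \<and> complex_manifold (mfd G) \<and> points (mfd G) = carrier G \<and>
     holo_map (prod_mfd (mfd G) (mfd G)) (mfd G) (\<lambda>(g, h). g \<otimes>\<^bsub>G\<^esub> h) \<and>
     holo_map (mfd G) (mfd G) (m_inv G)"

definition lie_algebra :: "('g, 'n::complex_fd_space) lie_group \<Rightarrow> ('g, 'n) tvec set" where
  "lie_algebra G = tangent (mfd G) \<one>\<^bsub>G\<^esub>"

text \<open>\<open>ltrans G g h\<close> and \<open>rtrans G g h\<close> are the differentials at \<open>h\<close> of the translations
  \<open>k \<mapsto> g k\<close> and \<open>k \<mapsto> k g\<close>.\<close>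

definition ltrans ::
  "('g, 'n::complex_fd_space) lie_group \<Rightarrow> 'g \<Rightarrow> 'g \<Rightarrow> ('g, 'n) tvec \<Rightarrow> ('g, 'n) tvec" where
  "ltrans G g = tderiv (mfd G) (mfd G) (\<lambda>k. g \<otimes>\<^bsub>G\<^esub> k)"

definition rtrans ::
  "('g, 'n::complex_fd_space) lie_group \<Rightarrow> 'g \<Rightarrow> 'g \<Rightarrow> ('g, 'n) tvec \<Rightarrow> ('g, 'n) tvec" where
  "rtrans G g = tderiv (mfd G) (mfd G) (\<lambda>k. k \<otimes>\<^bsub>G\<^esub> g)"

definition Ad :: "('g, 'n::complex_fd_space) lie_group \<Rightarrow> 'g \<Rightarrow> ('g, 'n) tvec \<Rightarrow> ('g, 'n) tvec" where
  "Ad G g = tderiv (mfd G) (mfd G) (\<lambda>k. g \<otimes>\<^bsub>G\<^esub> k \<otimes>\<^bsub>G\<^esub> m_inv G g) \<one>\<^bsub>G\<^esub>"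

text \<open>The commutator \<open>X Y - Y X\<close> of vector fields, whose coordinates in a chart are
  \<open>dY(X) - dX(Y)\<close>.\<close>

definition vf_bracket :: "('a, 'v::real_normed_vector) manifold \<Rightarrow> ('a \<Rightarrow> ('a, 'v) tvec) \<Rightarrow>
    ('a \<Rightarrow> ('a, 'v) tvec) \<Rightarrow> 'a \<Rightarrow> ('a, 'v) tvec" where
  "vf_bracket M X Y x = (\<lambda>c. if c \<in> charts_at M x
     then frechet_derivative (\<lambda>z. Y (chart_inv c z) c) (at (snd c x)) (X x c)
        - frechet_derivative (\<lambda>z. X (chart_inv c z) c) (at (snd c x)) (Y x c)
     else 0)"

definition left_invariant_field ::
  "('g, 'n::complex_fd_space) lie_group \<Rightarrow> ('g, 'n) tvec \<Rightarrow> 'g \<Rightarrow> ('g, 'n) tvec" where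
  "left_invariant_field G \<xi> g = ltrans G g \<one>\<^bsub>G\<^esub> \<xi>"

definition lie_bracket ::
  "('g, 'n::complex_fd_space) lie_group \<Rightarrow> ('g, 'n) tvec \<Rightarrow> ('g, 'n) tvec \<Rightarrow> ('g, 'n) tvec" where
  "lie_bracket G \<xi> \<eta> =
     vf_bracket (mfd G) (left_invariant_field G \<xi>) (left_invariant_field G \<eta>) \<one>\<^bsub>G\<^esub>"

type_synonym ('a, 'm, 'g, 'n) lie_form1 = "'a \<Rightarrow> ('a, 'm) tvec \<Rightarrow> ('g, 'n) tvec"
type_synonym ('a, 'm, 'g, 'n) lie_form2 = "'a \<Rightarrow> ('a, 'm) tvec \<Rightarrow> ('a, 'm) tvec \<Rightarrow> ('g, 'n) tvec"

text \<open>The coefficient function, in the chart \<open>c\<close>, of \<open>\<omega>\<close> on the vector field with constant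
  coordinates \<open>w\<close>.\<close>

definition form_coeff :: "('a, 'm::real_normed_vector) manifold \<Rightarrow> ('a, 'm, 'g, 'n) lie_form1 \<Rightarrow>
    ('a, 'm) chart \<Rightarrow> 'm \<Rightarrow> 'm \<Rightarrow> ('g, 'n) tvec" where
  "form_coeff M \<omega> c w z = \<omega> (chart_inv c z) (coord_vec M c (chart_inv c z) w)"

definition is_lie_form :: "('a, 'm::complex_fd_space) manifold \<Rightarrow> ('g, 'n::complex_fd_space) lie_group \<Rightarrow>
    ('a, 'm, 'g, 'n) lie_form1 \<Rightarrow> bool" where
  "is_lie_form M G \<omega> \<longleftrightarrow>
     (\<forall>x\<in>points M. \<forall>v\<in>tangent M x. \<omega> x v \<in> lie_algebra G) \<and>
     (\<forall>x\<in>points M. \<forall>u\<in>tangent M x. \<forall>v\<in>tangent M x. \<omega> x (u + v) = \<omega> x u + \<omega> x v) \<and>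
     (\<forall>x\<in>points M. \<forall>v\<in>tangent M x. \<forall>r::real.
        \<omega> x (complex_of_real r *\<^sub>C v) = complex_of_real r *\<^sub>C \<omega> x v) \<and>
     (\<forall>c\<in>atlas M. \<forall>w. \<forall>d\<in>charts_at (mfd G) \<one>\<^bsub>G\<^esub>.
        smooth_on (snd c ` fst c) (\<lambda>z. form_coeff M \<omega> c w z d))"

definition Omega01 :: "('a, 'm::complex_fd_space) manifold \<Rightarrow> ('g, 'n::complex_fd_space) lie_group \<Rightarrow>
    ('a, 'm, 'g, 'n) lie_form1 set" where
  "Omega01 M G = {\<omega>. is_lie_form M G \<omega> \<and>
     (\<forall>x\<in>points M. \<forall>v\<in>tangent M x. \<omega> x (\<i> *\<^sub>C v) = - (\<i> *\<^sub>C \<omega> x v))}"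

text \<open>\<open>d\<omega>(u, v) = u(\<omega>(v)) - v(\<omega>(u))\<close> for vector fields that are constant in a chart; the choice of
  the chart is immaterial for smooth \<open>\<omega>\<close>.\<close>

definition ext_deriv :: "('a, 'm::real_normed_vector) manifold \<Rightarrow>
    ('a, 'm, 'g, 'n::real_normed_vector) lie_form1 \<Rightarrow> ('a, 'm, 'g, 'n) lie_form2" where
  "ext_deriv M \<omega> x u v = (let c = (SOME c. c \<in> charts_at M x) in
     (\<lambda>d. frechet_derivative (\<lambda>z. form_coeff M \<omega> c (v c) z d) (at (snd c x)) (u c)
        - frechet_derivative (\<lambda>z. form_coeff M \<omega> c (u c) z d) (at (snd c x)) (v c)))"

text \<open>The components of type (0,1) of a 1-form and of type (0,2) of a 2-form, see the uniqueness
  lemmas below.\<close>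

definition part01 :: "('a, 'm::complex_fd_space, 'g, 'n::complex_fd_space) lie_form1 \<Rightarrow>
    ('a, 'm, 'g, 'n) lie_form1" where
  "part01 \<alpha> x v = (1 / 2) *\<^sub>C (\<alpha> x v + \<i> *\<^sub>C \<alpha> x (\<i> *\<^sub>C v))"

definition part02 :: "('a, 'm::complex_fd_space, 'g, 'n::complex_fd_space) lie_form2 \<Rightarrow>
    ('a, 'm, 'g, 'n) lie_form2" where
  "part02 \<eta> x u v = (1 / 4) *\<^sub>C (\<eta> x u v + \<i> *\<^sub>C \<eta> x (\<i> *\<^sub>C u) v + \<i> *\<^sub>C \<eta> x u (\<i> *\<^sub>C v)
     - \<eta> x (\<i> *\<^sub>C u) (\<i> *\<^sub>C v))"

lemma part01_unique:
  assumes T: "\<And>v. v \<in> T \<Longrightarrow> \<i> *\<^sub>C v \<in> T"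
    and "\<And>v. v \<in> T \<Longrightarrow> \<alpha> x v = \<beta> v + \<gamma> v"
    and "\<And>v. v \<in> T \<Longrightarrow> \<beta> (\<i> *\<^sub>C v) = \<i> *\<^sub>C \<beta> v"
    and "\<And>v. v \<in> T \<Longrightarrow> \<gamma> (\<i> *\<^sub>C v) = - (\<i> *\<^sub>C \<gamma> v)"
    and "v \<in> T"
  shows "part01 \<alpha> x v = \<gamma> v"
proof
  fix d
  have "part01 \<alpha> x v d = (1 / 2) *\<^sub>C (\<gamma> v d + \<gamma> v d)"
    using assms by (simp add: part01_def scaleC_fun_def scaleC_add_right scaleC_minus_right
        scaleC_diff_right scaleC_scaleC scaleC_minus_left)
  also have "\<gamma> v d + \<gamma> v d = 2 *\<^sub>C \<gamma> v d"
    using scaleC_add_left[of 1 1 "\<gamma> v d"] by simp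
  finally show "part01 \<alpha> x v d = \<gamma> v d" by (simp add: scaleC_scaleC)
qed

lemma part02_unique:
  assumes T: "\<And>v. v \<in> T \<Longrightarrow> \<i> *\<^sub>C v \<in> T"
    and "\<And>u v. u \<in> T \<Longrightarrow> v \<in> T \<Longrightarrow> \<eta> x u v = \<alpha> u v + (\<beta> u v + \<beta>' u v) + \<gamma> u v"
    and "\<And>u v. u \<in> T \<Longrightarrow> v \<in> T \<Longrightarrow>
      \<alpha> (\<i> *\<^sub>C u) v = \<i> *\<^sub>C \<alpha> u v \<and> \<alpha> u (\<i> *\<^sub>C v) = \<i> *\<^sub>C \<alpha> u v"
    and "\<And>u v. u \<in> T \<Longrightarrow> v \<in> T \<Longrightarrow>
      \<beta> (\<i> *\<^sub>C u) v = \<i> *\<^sub>C \<beta> u v \<and> \<beta> u (\<i> *\<^sub>C v) = - (\<i> *\<^sub>C \<beta> u v)"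
    and "\<And>u v. u \<in> T \<Longrightarrow> v \<in> T \<Longrightarrow>
      \<beta>' (\<i> *\<^sub>C u) v = - (\<i> *\<^sub>C \<beta>' u v) \<and> \<beta>' u (\<i> *\<^sub>C v) = \<i> *\<^sub>C \<beta>' u v"
    and "\<And>u v. u \<in> T \<Longrightarrow> v \<in> T \<Longrightarrow>
      \<gamma> (\<i> *\<^sub>C u) v = - (\<i> *\<^sub>C \<gamma> u v) \<and> \<gamma> u (\<i> *\<^sub>C v) = - (\<i> *\<^sub>C \<gamma> u v)"
    and "u \<in> T" "v \<in> T"
  shows "part02 \<eta> x u v = \<gamma> u v"
proof
  fix d
  have "part02 \<eta> x u v d = (1 / 4) *\<^sub>C (\<gamma> u v d + \<gamma> u v d + (\<gamma> u v d + \<gamma> u v d))"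
    using assms by (simp add: part02_def scaleC_fun_def scaleC_add_right scaleC_minus_right
        scaleC_diff_right scaleC_scaleC scaleC_minus_left)
  also have "\<gamma> u v d + \<gamma> u v d + (\<gamma> u v d + \<gamma> u v d) = 4 *\<^sub>C \<gamma> u v d"
    using scaleC_add_left[of 1 1 "\<gamma> u v d"] scaleC_add_left[of 2 2 "\<gamma> u v d"] by simp
  finally show "part02 \<eta> x u v d = \<gamma> u v d" by (simp add: scaleC_scaleC)
qed

definition dbar :: "('a, 'm::complex_fd_space) manifold \<Rightarrow>
    ('a, 'm, 'g, 'n::complex_fd_space) lie_form1 \<Rightarrow> ('a, 'm, 'g, 'n) lie_form2" where
  "dbar M \<omega> = part02 (ext_deriv M \<omega>)"

definition form_bracket :: "('g, 'n::complex_fd_space) lie_group \<Rightarrow> ('a, 'm, 'g, 'n) lie_form1 \<Rightarrow>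
    ('a, 'm, 'g, 'n) lie_form1 \<Rightarrow> ('a, 'm, 'g, 'n) lie_form2" where
  "form_bracket G \<alpha> \<beta> x u v = lie_bracket G (\<alpha> x u) (\<beta> x v) - lie_bracket G (\<alpha> x v) (\<beta> x u)"

definition integrable_form :: "('a, 'm::complex_fd_space) manifold \<Rightarrow>
    ('g, 'n::complex_fd_space) lie_group \<Rightarrow> ('a, 'm, 'g, 'n) lie_form1 \<Rightarrow> bool" where
  "integrable_form M G \<omega> \<longleftrightarrow> (\<forall>x\<in>points M. \<forall>u\<in>tangent M x. \<forall>v\<in>tangent M x.
     dbar M \<omega> x u v + (1 / 2) *\<^sub>C form_bracket G \<omega> \<omega> x u v = 0)"

definition left_log_deriv :: "('a, 'm::complex_fd_space) manifold \<Rightarrow>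
    ('g, 'n::complex_fd_space) lie_group \<Rightarrow> ('a \<Rightarrow> 'g) \<Rightarrow> ('a, 'm, 'g, 'n) lie_form1" where
  "left_log_deriv M G f x v = ltrans G (m_inv G (f x)) (f x) (tderiv M (mfd G) f x v)"

definition left_log_dbar :: "('a, 'm::complex_fd_space) manifold \<Rightarrow>
    ('g, 'n::complex_fd_space) lie_group \<Rightarrow> ('a \<Rightarrow> 'g) \<Rightarrow> ('a, 'm, 'g, 'n) lie_form1" where
  "left_log_dbar M G f = part01 (left_log_deriv M G f)"

definition Ad_inv_form :: "('g, 'n::complex_fd_space) lie_group \<Rightarrow> ('a \<Rightarrow> 'g) \<Rightarrow>
    ('a, 'm, 'g, 'n) lie_form1 \<Rightarrow> ('a, 'm, 'g, 'n) lie_form1" where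
  "Ad_inv_form G f \<omega> x v = inv_into (lie_algebra G) (Ad G (f x)) (\<omega> x v)"

text \<open>The complex structure of the total space is given as an almost complex structure on the
  underlying smooth manifold; a map between two such spaces is holomorphic if it is smooth and its
  differential intertwines the two structures.\<close>

record ('p, 'u, 'a, 'g) principal_bundle =
  total :: "('p, 'u) manifold"
  cstruct :: "'p \<Rightarrow> ('p, 'u) tvec \<Rightarrow> ('p, 'u) tvec"
  proj :: "'p \<Rightarrow> 'a"
  act :: "'p \<Rightarrow> 'g \<Rightarrow> 'p"

definition bundle_holo :: "('p, 'u::real_normed_vector, 'a, 'g) principal_bundle \<Rightarrow>
    ('q, 'w::real_normed_vector, 'a, 'g) principal_bundle \<Rightarrow> ('p \<Rightarrow> 'q) \<Rightarrow> bool" where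
  "bundle_holo P Q \<Phi> \<longleftrightarrow> smooth_map (total P) (total Q) \<Phi> \<and>
     (\<forall>p\<in>points (total P). \<forall>t\<in>tangent (total P) p.
        tderiv (total P) (total Q) \<Phi> p (cstruct P p t) =
        cstruct Q (\<Phi> p) (tderiv (total P) (total Q) \<Phi> p t))"

definition bundle_biholo :: "('p, 'u::real_normed_vector, 'a, 'g) principal_bundle \<Rightarrow>
    ('q, 'w::real_normed_vector, 'a, 'g) principal_bundle \<Rightarrow> ('p \<Rightarrow> 'q) \<Rightarrow> bool" where
  "bundle_biholo P Q \<Phi> \<longleftrightarrow> bij_betw \<Phi> (points (total P)) (points (total Q)) \<and>
     bundle_holo P Q \<Phi> \<and> bundle_holo Q P (inv_into (points (total P)) \<Phi>)"

definition holo_equivalent :: "('g, 'n) lie_group \<Rightarrow> ('p, 'u::real_normed_vector, 'a, 'g) principal_bundle \<Rightarrow>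
    ('q, 'w::real_normed_vector, 'a, 'g) principal_bundle \<Rightarrow> bool" where
  "holo_equivalent G P Q \<longleftrightarrow> (\<exists>\<Phi>. bundle_biholo P Q \<Phi> \<and>
     (\<forall>p\<in>points (total P). proj Q (\<Phi> p) = proj P p) \<and>
     (\<forall>p\<in>points (total P). \<forall>g\<in>carrier G. \<Phi> (act P p g) = act Q (\<Phi> p) g))"

text \<open>\<open>I\<^sub>\<omega>(v, w) = (\<i> v, \<i> w + 2 \<i> \<omega>(v).g)\<close> for \<open>t = (v, w)\<close>.\<close>

definition I_form :: "('a, 'm::complex_fd_space) manifold \<Rightarrow> ('g, 'n::complex_fd_space) lie_group \<Rightarrow>
    ('a, 'm, 'g, 'n) lie_form1 \<Rightarrow> 'a \<times> 'g \<Rightarrow> ('a \<times> 'g, 'm \<times> 'n) tvec \<Rightarrow> ('a \<times> 'g, 'm \<times> 'n) tvec" where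
  "I_form M G \<omega> p t =
     (let P = prod_mfd M (mfd G); x = fst p; g = snd p;
          v = tderiv P M fst p t; w = tderiv P (mfd G) snd p t
      in tpair M (mfd G) p (\<i> *\<^sub>C v) (\<i> *\<^sub>C w + (2 * \<i>) *\<^sub>C rtrans G g \<one>\<^bsub>G\<^esub> (\<omega> x v)))"

definition form_bundle :: "('a, 'm::complex_fd_space) manifold \<Rightarrow> ('g, 'n::complex_fd_space) lie_group \<Rightarrow>
    ('a, 'm, 'g, 'n) lie_form1 \<Rightarrow> ('a \<times> 'g, 'm \<times> 'n, 'a, 'g) principal_bundle" where
  "form_bundle M G \<omega> = \<lparr>total = prod_mfd M (mfd G), cstruct = I_form M G \<omega>,
     proj = fst, act = (\<lambda>p g. (fst p, snd p \<otimes>\<^bsub>G\<^esub> g))\<rparr>"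

end

theory Submission
  imports Defs
begin

text \<open>
A bundle map \<open>\<Phi>\<close> over the identity of \<open>M\<close> that commutes with the right action of \<open>G\<close> on \<open>M \<times> G\<close> is
the same thing as a map \<open>f : M \<rightarrow> G\<close>, by \<open>\<Phi>(x, g) = (x, f(x) g)\<close>: the value \<open>f(x)\<close> is read off at
\<open>(x, 1)\<close>. Smoothness of \<open>\<Phi>\<close> and of \<open>f\<close> are equivalent, and \<open>\<Phi>\<close> is always bijective with an inverse
of the same form, given by \<open>f\<^sup>-\<^sup>1\<close>. So the theorem is a statement about when \<open>d\<Phi>\<close> intertwines
the two almost complex structures.

This is a pointwise computation. At \<open>(x, g)\<close> the differential sends \<open>(v, w)\<close> to
\<open>(v, df(v).g + f.w)\<close>. Comparing the \<open>G\<close>-components of \<open>d\<Phi> \<circ> I\<close> for \<open>\<omega>\<^sub>1\<close> and \<open>I \<circ> d\<Phi>\<close> for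
\<open>\<omega>\<^sub>2\<close>, and cancelling \<open>\<i> f.w\<close> and the right translation by \<open>g\<close>, gives

\<open>df(\<i> v) + 2 \<i> f.\<omega>\<^sub>1(v) = \<i> df(v) + 2 \<i> \<omega>\<^sub>2(v).f\<close>.

After left translation by \<open>f\<^sup>-\<^sup>1\<close>, with \<open>\<alpha> = f\<^sup>-\<^sup>1.df\<close>, this becomes
\<open>\<omega>\<^sub>1(v) = (\<alpha>(v) + \<i> \<alpha>(\<i> v)) / 2 + Ad(f)\<^sup>-\<^sup>1 \<omega>\<^sub>2(v)\<close>, and the first summand is the component of type
(0,1) of \<open>\<alpha>\<close>. The computation is \<open>gauge_intertwines_iff\<close>; it rests on the complex linearity of the
differentials of translations and on their commutation rules. The passage between equivalences and
maps \<open>f\<close> is \<open>holo_equivalent_imp_gauge\<close> and \<open>gauge_bundle_biholo\<close>.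

Most of the development provides the differential calculus that this argument takes for granted: the
chain rule for smooth maps between finite-dimensional spaces (\<open>cont_diff_on_compose\<close>), its version
for manifolds (\<open>tderiv_compose\<close>), and the description of tangent vectors of a product by their two
projections (\<open>tangent_prod_eqI\<close>, \<open>tderiv_tpair\<close>).
\<close>

section \<open>Smooth maps between finite-dimensional spaces\<close>

text \<open>Coefficients are controlled by the norm because the faces \<open>c b = 1\<close> of the cube of coefficients are
compact: on such a face the linear combination does not vanish, by independence, so its norm has a
positive lower bound, and any nonzero family of coefficients can be scaled into the face that
belongs to its largest member.\<close>

lemma independent_coordinates_bounded:
  fixes B :: "'a::real_normed_vector set"
  assumes fin: "finite B" and indep: "independent B"
  obtains K where "\<And>c b. b \<in> B \<Longrightarrow> \<bar>c b\<bar> \<le> K * norm (\<Sum>b\<in>B. c b *\<^sub>R b)"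
proof -
  define F where "F = (\<lambda>c. \<Sum>b\<in>B. c b *\<^sub>R b)"
  define T where "T = product_topology (\<lambda>b::'a. euclideanreal) B"
  \<comment> \<open>\<open>C b\<close> is the face of the cube on which the coefficient of \<open>b\<close> is 1.\<close>
  define C where "C = (\<lambda>b. PiE B (\<lambda>b'. if b' = b then {1::real} else {-1..1}))"
  have contF: "continuous_map T euclidean F"
    unfolding F_def
  proof (intro continuous_map_sum fin)
    fix b assume "b \<in> B"
    then have "continuous_map T euclideanreal (\<lambda>c. c b)"
      unfolding T_def by (intro continuous_map_product_projection)
    moreover have "continuous_map euclideanreal euclidean (\<lambda>r. r *\<^sub>R b)"
      by (simp add: continuous_on_scaleR)
    ultimately show "continuous_map T euclidean (\<lambda>c. c b *\<^sub>R b)"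
      using continuous_map_compose[of T euclideanreal "\<lambda>c. c b" euclidean "\<lambda>r. r *\<^sub>R b"] by (simp add: o_def)
  qed
  have "\<exists>\<delta>>0. \<forall>c\<in>C b. \<delta> \<le> norm (F c)" if b: "b \<in> B" for b
  proof -
    have "compactin T (C b)"
      unfolding T_def C_def by (auto simp: compactin_PiE)
    then have "compact (F ` C b)"
      using image_compactin[OF _ contF] by (simp add: compactin_euclidean_iff)
    moreover have "0 \<notin> F ` C b"
    proof
      assume "0 \<in> F ` C b"
      then obtain c where c: "c \<in> C b" "F c = 0" by auto
      then have "c b = 0"
        using indep fin b unfolding F_def by (auto simp: independent_explicit dependent_finite)
      moreover have "c b = 1" using c(1) b unfolding C_def by (auto dest: PiE_mem)
      ultimately show False by simp
    qed
    ultimately obtain \<delta> where "\<delta> > 0" "ball 0 \<delta> \<subseteq> - F ` C b"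
      using compact_imp_closed[of "F ` C b"] openE[of "- F ` C b" 0] by (auto simp: open_Compl)
    then show ?thesis by (force simp: not_less[symmetric])
  qed
  then obtain \<delta> where \<delta>: "\<And>b. b \<in> B \<Longrightarrow> \<delta> b > 0" "\<And>b c. b \<in> B \<Longrightarrow> c \<in> C b \<Longrightarrow> \<delta> b \<le> norm (F c)"
    by metis
  have "\<bar>c b\<bar> \<le> (\<Sum>b\<in>B. 1 / \<delta> b) * norm (F c)" if b: "b \<in> B" for c b
  proof -
    have nonneg: "(\<Sum>b\<in>B. 1 / \<delta> b) \<ge> 0" using \<delta>(1) by (intro sum_nonneg) (simp add: less_imp_le)
    have "Max ((\<lambda>b. \<bar>c b\<bar>) ` B) \<in> (\<lambda>b. \<bar>c b\<bar>) ` B"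
      using fin b by (intro Max_in) auto
    then obtain b0 where "b0 \<in> B" "Max ((\<lambda>b. \<bar>c b\<bar>) ` B) = \<bar>c b0\<bar>" by blast
    moreover have "\<bar>c b\<bar> \<le> Max ((\<lambda>b. \<bar>c b\<bar>) ` B)" if "b \<in> B" for b
      using fin that by (intro Max_ge) auto
    ultimately have b0: "b0 \<in> B" "\<And>b. b \<in> B \<Longrightarrow> \<bar>c b\<bar> \<le> \<bar>c b0\<bar>"
      by auto
    show ?thesis
    proof (cases "c b0 = 0")
      case True
      then show ?thesis using b0(2)[OF b] nonneg by simp
    next
      case False
      let ?c = "restrict (\<lambda>b. c b / c b0) B"
      have "?c \<in> C b0"
        unfolding C_def
      proof (rule restrict_PiE_iff[THEN iffD2], intro ballI)
        fix b assume "b \<in> B"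
        then have "\<bar>c b / c b0\<bar> \<le> 1" using b0(2) False by simp
        then have "-1 \<le> c b / c b0" "c b / c b0 \<le> 1" by linarith+
        then show "c b / c b0 \<in> (if b = b0 then {1} else {-1..1})" using False by simp
      qed
      then have "\<delta> b0 \<le> norm (F ?c)" using \<delta>(2) b0(1) by blast
      also have "F ?c = (1 / c b0) *\<^sub>R F c"
        unfolding F_def scaleR_sum_right by (rule sum.cong) auto
      finally have "\<bar>c b0\<bar> \<le> (1 / \<delta> b0) * norm (F c)"
        using False \<delta>(1)[OF b0(1)] by (simp add: field_simps)
      also have "\<dots> \<le> (\<Sum>b\<in>B. 1 / \<delta> b) * norm (F c)"
        using \<delta>(1) by (intro mult_right_mono member_le_sum b0 fin) (auto simp: less_imp_le)
      finally show ?thesis using b0(2)[OF b] by simp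
    qed
  qed
  then show thesis using that unfolding F_def by blast
qed

text \<open>Smoothness is real smoothness, so real coordinates are needed although the spanning sets of the
class are complex; a complex spanning set together with its multiples by \<open>\<i>\<close> spans over the
reals.\<close>

lemma continuous_real_coordinates:
  obtains B :: "'a::complex_fd_space set" and c :: "'a \<Rightarrow> 'a \<Rightarrow> real"
  where "finite B" "\<And>b. bounded_linear (c b)" "\<And>x. x = (\<Sum>b\<in>B. c b x *\<^sub>R b)"
proof -
  obtain A :: "'a set" where A: "finite A" "\<forall>x. \<exists>c. x = (\<Sum>b\<in>A. c b *\<^sub>C b)"
    using finite_spanning by blast
  let ?A = "A \<union> (\<lambda>b. \<i> *\<^sub>C b) ` A"
  have span: "x \<in> span ?A" for x
  proof -
    obtain c where "x = (\<Sum>b\<in>A. c b *\<^sub>C b)" using A by blast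
    moreover have "c b *\<^sub>C b = Re (c b) *\<^sub>R b + Im (c b) *\<^sub>R (\<i> *\<^sub>C b)" for b
      by (simp add: scaleC_of_real[symmetric] scaleC_scaleC scaleC_add_left[symmetric]
          complex_eq[of "c b", symmetric] mult.commute)
    ultimately show ?thesis
      by (simp only:) (intro span_sum span_add span_scale span_base; blast)
  qed
  obtain B where B: "B \<subseteq> ?A" "independent B" "?A \<subseteq> span B"
    using maximal_independent_subset[of ?A] by blast
  have finB: "finite B" using B(1) A(1) finite_subset by blast
  have spanB: "span B = UNIV"
    using span span_mono[OF B(3)] by (auto simp: span_span)
  obtain K where K: "\<And>c b. b \<in> B \<Longrightarrow> \<bar>c b\<bar> \<le> K * norm (\<Sum>b\<in>B. c b *\<^sub>R b)"
    using independent_coordinates_bounded[OF finB B(2)] by blast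
  let ?c = "\<lambda>b x. representation B x b"
  have sum: "(\<Sum>b\<in>B. ?c b x *\<^sub>R b) = x" for x
    using sum_representation_eq[OF B(2) _ finB] spanB by auto
  have "bounded_linear (?c b)" for b
  proof (rule bounded_linear_intro[where K = "if b \<in> B then K else 0"])
    show "norm (?c b x) \<le> norm x * (if b \<in> B then K else 0)" for x
      using K[of b "\<lambda>b. ?c b x"] sum[of x] representation_ne_zero[of B x b]
      by (auto simp: mult.commute)
  qed (use B(2) spanB in \<open>auto simp: representation_add representation_scale\<close>)
  then show thesis using that[of B ?c] finB sum by auto
qed

lemma cont_diff_on_cong:
  assumes "open S" "\<And>x. x \<in> S \<Longrightarrow> f x = g x"
  shows "cont_diff_on k S f \<longleftrightarrow> cont_diff_on k S g"
  using assms(2)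
proof (induction k arbitrary: f g)
  case 0
  then show ?case by (simp cong: continuous_on_cong)
next
  case (Suc k)
  have diff: "f differentiable at x \<longleftrightarrow> g differentiable at x" if "x \<in> S" for x
    using has_derivative_transform_within_open[OF _ assms(1) that] Suc.prems
    unfolding differentiable_def by metis
  show ?case
  proof (cases "\<forall>x\<in>S. f differentiable at x")
    case True
    then have "frechet_derivative f (at x) = frechet_derivative g (at x)" if "x \<in> S" for x
      using frechet_derivative_transform_within_open[OF _ assms(1) that] Suc.prems that by blast
    then show ?thesis
      using Suc.IH[of "\<lambda>x. frechet_derivative f (at x) v" "\<lambda>x. frechet_derivative g (at x) v" for v]
        diff by auto
  qed (use diff in auto)
qed

text \<open>Any formula for the derivative that is valid on \<open>S\<close> may replace the derivative selected by
\<^const>\<open>frechet_derivative\<close>, which is unspecified at points where the map is not differentiable.\<close>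

lemma cont_diff_on_SucI:
  assumes "open S" "\<And>x. x \<in> S \<Longrightarrow> (f has_derivative f' x) (at x)"
    "\<And>v. cont_diff_on k S (\<lambda>x. f' x v)"
  shows "cont_diff_on (Suc k) S f"
proof -
  have "frechet_derivative f (at x) = f' x" if "x \<in> S" for x
    using assms(2)[OF that] frechet_derivative_at by metis
  then have "cont_diff_on k S (\<lambda>x. frechet_derivative f (at x) v)" for v
    using cont_diff_on_cong[OF assms(1), of "\<lambda>x. frechet_derivative f (at x) v" "\<lambda>x. f' x v" k] assms(3)
    by simp
  then show ?thesis using assms(2) by (auto simp: differentiable_def)
qed

lemma cont_diff_on_Suc_has_derivative:
  "cont_diff_on (Suc k) S f \<Longrightarrow> x \<in> S \<Longrightarrow> (f has_derivative frechet_derivative f (at x)) (at x)"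
  by (simp add: frechet_derivative_works[symmetric])

lemma cont_diff_on_SucD: "cont_diff_on (Suc k) S f \<Longrightarrow> cont_diff_on k S f"
proof (induction k arbitrary: f)
  case 0
  then show ?case
    by (auto simp: continuous_at_imp_continuous_on differentiable_imp_continuous_within)
qed auto

lemma cont_diff_on_subset: "cont_diff_on k S f \<Longrightarrow> T \<subseteq> S \<Longrightarrow> cont_diff_on k T f"
  by (induction k arbitrary: f) (auto intro: continuous_on_subset)

lemma cont_diff_on_local:
  assumes "\<And>x. x \<in> S \<Longrightarrow> \<exists>T. open T \<and> x \<in> T \<and> cont_diff_on k T f"
  shows "cont_diff_on k S f"
  using assms
proof (induction k arbitrary: f)
  case 0
  then have "isCont f x" if "x \<in> S" for x
    using that by (metis cont_diff_on.simps(1) continuous_on_eq_continuous_at)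
  then show ?case by (simp add: continuous_at_imp_continuous_on)
next
  case (Suc k)
  then show ?case by (fastforce simp del: split_paired_Ex)
qed

lemma cont_diff_on_const: "open S \<Longrightarrow> cont_diff_on k S (\<lambda>x. a)"
  by (induction k arbitrary: a) auto

lemma cont_diff_on_add:
  assumes "open S"
  shows "cont_diff_on k S f \<Longrightarrow> cont_diff_on k S g \<Longrightarrow> cont_diff_on k S (\<lambda>x. f x + g x)"
proof (induction k arbitrary: f g)
  case (Suc k)
  show ?case
    by (rule cont_diff_on_SucI[OF assms has_derivative_add[OF cont_diff_on_Suc_has_derivative[OF Suc.prems(1)] cont_diff_on_Suc_has_derivative[OF Suc.prems(2)]]])
      (use Suc in auto)
qed (auto intro: continuous_on_add)

lemma cont_diff_on_sum:
  assumes "open S" "\<And>i. i \<in> I \<Longrightarrow> cont_diff_on k S (f i)"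
  shows "cont_diff_on k S (\<lambda>x. \<Sum>i\<in>I. f i x)"
  using assms(2)
  by (induction I rule: infinite_finite_induct)
    (auto intro: cont_diff_on_const cont_diff_on_add assms(1))

lemma cont_diff_on_bounded_linear:
  assumes "open S" "bounded_linear L"
  shows "cont_diff_on k S f \<Longrightarrow> cont_diff_on k S (\<lambda>x. L (f x))"
proof (induction k arbitrary: f)
  case 0
  then show ?case using bounded_linear.continuous_on[OF assms(2)] by simp
next
  case (Suc k)
  show ?case
    by (rule cont_diff_on_SucI[OF assms(1)
          bounded_linear.has_derivative[OF assms(2) cont_diff_on_Suc_has_derivative[OF Suc.prems]]])
      (use Suc in auto)
qed

lemma cont_diff_on_scaleR:
  assumes "open S"
  shows "cont_diff_on k S f \<Longrightarrow> cont_diff_on k S g \<Longrightarrow> cont_diff_on k S (\<lambda>x. f x *\<^sub>R g x)"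
proof (induction k arbitrary: f g)
  case 0
  then show ?case by (auto intro: continuous_on_scaleR)
next
  case (Suc k)
  note fg = Suc.prems Suc.prems[THEN cont_diff_on_SucD]
  show ?case
  proof (rule cont_diff_on_SucI[OF assms])
    show "((\<lambda>x. f x *\<^sub>R g x) has_derivative (\<lambda>v. f x *\<^sub>R frechet_derivative g (at x) v
        + frechet_derivative f (at x) v *\<^sub>R g x)) (at x)" if "x \<in> S" for x
      using that fg by (intro has_derivative_scaleR cont_diff_on_Suc_has_derivative)
    show "cont_diff_on k S (\<lambda>x. f x *\<^sub>R frechet_derivative g (at x) v
        + frechet_derivative f (at x) v *\<^sub>R g x)" for v
      using fg by (intro cont_diff_on_add assms Suc.IH) auto
  qed
qed

lemma cont_diff_on_Pair:
  assumes "open S"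
  shows "cont_diff_on k S f \<Longrightarrow> cont_diff_on k S g \<Longrightarrow> cont_diff_on k S (\<lambda>x. (f x, g x))"
proof (induction k arbitrary: f g)
  case 0
  then show ?case by (auto intro: continuous_on_Pair)
next
  case (Suc k)
  show ?case
    by (rule cont_diff_on_SucI[OF assms has_derivative_Pair[OF cont_diff_on_Suc_has_derivative[OF Suc.prems(1)] cont_diff_on_Suc_has_derivative[OF Suc.prems(2)]]])
      (use Suc in auto)
qed

text \<open>The inductive definition of \<^const>\<open>cont_diff_on\<close> only speaks about the derivative of \<open>f\<close> in a fixed
direction, whereas the chain rule evaluates it in the direction \<open>Dg(x)(v)\<close>, which moves with
\<open>x\<close>. Expanding this direction in a fixed basis gives a finite sum of products of functions to which
the induction hypothesis and the product rule apply; this is where finite dimension enters.\<close>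

lemma cont_diff_on_compose:
  fixes g :: "'a::real_normed_vector \<Rightarrow> 'b::complex_fd_space"
  assumes "open S" "open T" "g ` S \<subseteq> T"
  shows "cont_diff_on k T f \<Longrightarrow> cont_diff_on k S g \<Longrightarrow> cont_diff_on k S (\<lambda>x. f (g x))"
proof (induction k arbitrary: f)
  case 0
  then show ?case using assms(3) continuous_on_compose2[of T f S g] by auto
next
  case (Suc k)
  obtain B :: "'b set" and c where c: "finite B" "\<And>b. bounded_linear (c b)" "\<And>x. x = (\<Sum>b\<in>B. c b x *\<^sub>R b)"
    using continuous_real_coordinates by blast
  note fg = Suc.prems Suc.prems[THEN cont_diff_on_SucD]
  define Df where "Df = (\<lambda>x w. frechet_derivative f (at (g x)) w)"
  define Dg where "Dg = (\<lambda>x v. frechet_derivative g (at x) v)"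
  have deriv: "((\<lambda>x. f (g x)) has_derivative (\<lambda>v. Df x (Dg x v))) (at x)"
    and expand: "Df x w = (\<Sum>b\<in>B. c b w *\<^sub>R Df x b)" if x: "x \<in> S" for x w
  proof -
    have f: "(f has_derivative Df x) (at (g x))"
      unfolding Df_def using fg(1) assms(3) x by (intro cont_diff_on_Suc_has_derivative) auto
    have "(g has_derivative Dg x) (at x)"
      unfolding Dg_def using fg(2) x by (rule cont_diff_on_Suc_has_derivative)
    from diff_chain_at[OF this f] show "((\<lambda>x. f (g x)) has_derivative (\<lambda>v. Df x (Dg x v))) (at x)"
      by (simp only: o_def)
    have "Df x w = Df x (\<Sum>b\<in>B. c b w *\<^sub>R b)"
      by (rule arg_cong[OF c(3)[of w]])
    also have "\<dots> = (\<Sum>b\<in>B. c b w *\<^sub>R Df x b)"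
      by (simp add: linear_sum[OF has_derivative_linear[OF f]] linear_scale[OF has_derivative_linear[OF f]])
    finally show "Df x w = (\<Sum>b\<in>B. c b w *\<^sub>R Df x b)" .
  qed
  show ?case
  proof (rule cont_diff_on_SucI[OF assms(1) deriv])
    fix v
    have "cont_diff_on k S (\<lambda>x. \<Sum>b\<in>B. c b (Dg x v) *\<^sub>R Df x b)"
    proof (intro cont_diff_on_sum cont_diff_on_scaleR assms(1))
      show "cont_diff_on k S (\<lambda>x. c b (Dg x v))" for b
        using fg(2) by (auto simp: Dg_def intro: cont_diff_on_bounded_linear assms(1) c(2))
      show "cont_diff_on k S (\<lambda>x. Df x b)" for b
        unfolding Df_def by (rule Suc.IH) (use fg in auto)
    qed
    then show "cont_diff_on k S (\<lambda>x. Df x (Dg x v))"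
      by (rule cont_diff_on_cong[OF assms(1), THEN iffD1, rotated]) (rule expand[symmetric])
  qed
qed

lemma smooth_on_cong: "open S \<Longrightarrow> (\<And>x. x \<in> S \<Longrightarrow> f x = g x) \<Longrightarrow> smooth_on S f \<longleftrightarrow> smooth_on S g"
  using cont_diff_on_cong[of S f g] by (simp add: smooth_on_def)

lemma smooth_on_subset: "smooth_on S f \<Longrightarrow> T \<subseteq> S \<Longrightarrow> smooth_on T f"
  unfolding smooth_on_def by (blast intro: cont_diff_on_subset)

lemma smooth_on_local:
  "(\<And>x. x \<in> S \<Longrightarrow> \<exists>T. open T \<and> x \<in> T \<and> smooth_on T f) \<Longrightarrow> smooth_on S f"
  unfolding smooth_on_def using cont_diff_on_local by metis

lemma smooth_on_const: "open S \<Longrightarrow> smooth_on S (\<lambda>x. a)"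
  by (simp add: smooth_on_def cont_diff_on_const)

lemma smooth_on_bounded_linear:
  assumes "open S" "bounded_linear L"
  shows "smooth_on S L"
proof -
  have "cont_diff_on k S (\<lambda>x. x)" for k
    by (induction k) (auto simp: assms(1) cont_diff_on_const continuous_on_id)
  then show ?thesis
    using cont_diff_on_bounded_linear[OF assms, of _ "\<lambda>x. x"] by (simp add: smooth_on_def)
qed

lemma smooth_on_Pair:
  "open S \<Longrightarrow> smooth_on S f \<Longrightarrow> smooth_on S g \<Longrightarrow> smooth_on S (\<lambda>x. (f x, g x))"
  by (simp add: smooth_on_def cont_diff_on_Pair)

lemma smooth_on_compose:
  fixes g :: "'a::real_normed_vector \<Rightarrow> 'b::complex_fd_space"
  assumes "open S" "open T" "g ` S \<subseteq> T" "smooth_on T f" "smooth_on S g"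
  shows "smooth_on S (\<lambda>x. f (g x))"
  using cont_diff_on_compose[OF assms(1-3)] assms(4,5) by (auto simp: smooth_on_def)

lemma smooth_on_has_derivative:
  "smooth_on S f \<Longrightarrow> x \<in> S \<Longrightarrow> (f has_derivative frechet_derivative f (at x)) (at x)"
  unfolding smooth_on_def by (rule cont_diff_on_Suc_has_derivative[of 0]) auto

section \<open>Charts, smooth maps and differentials\<close>

lemma holo_on_cong:
  assumes "open S" "\<And>x. x \<in> S \<Longrightarrow> f x = g x" "holo_on S f"
  shows "holo_on S g"
proof -
  have "frechet_derivative f (at x) = frechet_derivative g (at x)" if "x \<in> S" for x
  proof (rule frechet_derivative_transform_within_open[OF _ assms(1) that assms(2)])
    show "f differentiable at x"
      using smooth_on_has_derivative assms(3) that unfolding holo_on_def differentiable_def by blast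
  qed
  then show ?thesis
    using assms smooth_on_cong[of S f g] unfolding holo_on_def by simp
qed

lemma holo_on_map_prod:
  fixes f :: "'a::complex_fd_space \<Rightarrow> 'c::complex_fd_space"
    and g :: "'b::complex_fd_space \<Rightarrow> 'd::complex_fd_space"
  assumes "open S" "open T" "holo_on S f" "holo_on T g"
  shows "holo_on (S \<times> T) (map_prod f g)"
proof -
  have sm: "smooth_on (S \<times> T) (\<lambda>p. (f (fst p), g (snd p)))"
  proof (rule smooth_on_Pair)
    show "smooth_on (S \<times> T) (\<lambda>p. f (fst p))"
      by (rule smooth_on_compose[where T = S])
        (use assms in \<open>auto simp: holo_on_def open_Times intro: smooth_on_bounded_linear bounded_linear_fst\<close>)
    show "smooth_on (S \<times> T) (\<lambda>p. g (snd p))"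
      by (rule smooth_on_compose[where T = T])
        (use assms in \<open>auto simp: holo_on_def open_Times intro: smooth_on_bounded_linear bounded_linear_snd\<close>)
  qed (simp add: assms open_Times)
  have "((\<lambda>p. (f (fst p), g (snd p))) has_derivative
      (\<lambda>v. (frechet_derivative f (at (fst p)) (fst v), frechet_derivative g (at (snd p)) (snd v)))) (at p)"
    if "p \<in> S \<times> T" for p
  proof (rule has_derivative_Pair)
    have "(f has_derivative frechet_derivative f (at (fst p))) (at (fst p))"
      using assms(3) that unfolding holo_on_def by (intro smooth_on_has_derivative[of S]) auto
    from diff_chain_at[OF bounded_linear_imp_has_derivative[OF bounded_linear_fst] this]
    show "((\<lambda>p. f (fst p)) has_derivative (\<lambda>v. frechet_derivative f (at (fst p)) (fst v))) (at p)"
      by (simp add: o_def)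
    have "(g has_derivative frechet_derivative g (at (snd p))) (at (snd p))"
      using assms(4) that unfolding holo_on_def by (intro smooth_on_has_derivative[of T]) auto
    from diff_chain_at[OF bounded_linear_imp_has_derivative[OF bounded_linear_snd] this]
    show "((\<lambda>p. g (snd p)) has_derivative (\<lambda>v. frechet_derivative g (at (snd p)) (snd v))) (at p)"
      by (simp add: o_def)
  qed
  then have "frechet_derivative (\<lambda>p. (f (fst p), g (snd p))) (at p) =
      (\<lambda>v. (frechet_derivative f (at (fst p)) (fst v), frechet_derivative g (at (snd p)) (snd v)))"
    if "p \<in> S \<times> T" for p
    using frechet_derivative_at[symmetric] that by blast
  moreover have "map_prod f g = (\<lambda>p. (f (fst p), g (snd p)))"
    by auto
  ultimately show ?thesis
    using sm assms(3,4) unfolding holo_on_def by (auto simp: scaleC_prod_def)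
qed

lemma is_chart_facts:
  assumes "is_chart T c"
  shows is_chart_subset: "fst c \<subseteq> topspace T"
    and is_chart_open: "openin T U \<Longrightarrow> open (snd c ` (fst c \<inter> U))"
    and chart_inv_chart: "x \<in> fst c \<Longrightarrow> chart_inv c (snd c x) = x"
proof -
  have h: "openin T (fst c)" "open (snd c ` fst c)"
    "homeomorphic_map (subtopology T (fst c)) (top_of_set (snd c ` fst c)) (snd c)"
    using assms by (auto simp: is_chart_def)
  show sub: "fst c \<subseteq> topspace T" using h(1) by (rule openin_subset)
  have inj: "inj_on (snd c) (fst c)"
    using homeomorphic_imp_injective_map[OF h(3)] sub by (simp add: inf.absorb2)
  show "chart_inv c (snd c x) = x" if "x \<in> fst c"
    using inj that by (simp add: chart_inv_def)
  show "open (snd c ` (fst c \<inter> U))" if "openin T U"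
  proof -
    have "openin (subtopology T (fst c)) (fst c \<inter> U)"
      using that by (simp add: openin_subtopology_Int2)
    then have "openin (top_of_set (snd c ` fst c)) (snd c ` (fst c \<inter> U))"
      using homeomorphic_imp_open_map[OF h(3)] by (simp add: open_map_def)
    then show ?thesis using h(2) by (simp add: openin_open_eq)
  qed
qed

lemma complex_manifold_is_chart:
  "complex_manifold M \<Longrightarrow> c \<in> atlas M \<Longrightarrow> is_chart (mtop M) c"
  by (simp add: complex_manifold_def)

lemma charts_at_nonempty:
  "complex_manifold M \<Longrightarrow> x \<in> points M \<Longrightarrow> \<exists>c. c \<in> charts_at M x"
  unfolding complex_manifold_def charts_at_def by blast

lemma atlas_subset: "complex_manifold M \<Longrightarrow> c \<in> atlas M \<Longrightarrow> fst c \<subseteq> points M"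
  by (rule is_chart_subset[OF complex_manifold_is_chart])

lemma openin_chart: "complex_manifold M \<Longrightarrow> c \<in> atlas M \<Longrightarrow> openin (mtop M) (fst c)"
  by (simp add: complex_manifold_def is_chart_def)

lemma open_chart_vimage:
  assumes "complex_manifold M" "c \<in> atlas M" "continuous_map (mtop M) T f" "openin T U"
  shows "open (snd c ` (fst c \<inter> f -` U))"
proof -
  have "openin (mtop M) {x \<in> points M. f x \<in> U}"
    using assms(3,4) by (rule openin_continuous_map_preimage)
  then have "open (snd c ` (fst c \<inter> {x \<in> points M. f x \<in> U}))"
    by (rule is_chart_open[OF complex_manifold_is_chart[OF assms(1,2)]])
  moreover have "fst c \<inter> {x \<in> points M. f x \<in> U} = fst c \<inter> f -` U"
    using atlas_subset[OF assms(1,2)] by auto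
  ultimately show ?thesis by simp
qed

lemma smooth_map_continuous: "smooth_map M N f \<Longrightarrow> continuous_map (mtop M) (mtop N) f"
  by (simp add: smooth_map_def)

lemma smooth_map_points: "smooth_map M N f \<Longrightarrow> x \<in> points M \<Longrightarrow> f x \<in> points N"
  by (auto simp: smooth_map_def continuous_map_def)

lemma open_local_rep_domain:
  assumes "complex_manifold M" "complex_manifold N" "continuous_map (mtop M) (mtop N) f"
    and "c \<in> atlas M" "d \<in> atlas N"
  shows "open (snd c ` (fst c \<inter> f -` fst d))"
  using open_chart_vimage[OF assms(1,4,3) openin_chart[OF assms(2,5)]] .

lemma local_rep_eq:
  assumes "complex_manifold M" "c \<in> atlas M" "x \<in> fst c"
  shows "local_rep c d f (snd c x) = snd d (f x)"
  using chart_inv_chart[OF complex_manifold_is_chart[OF assms(1,2)] assms(3)]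
  by (simp add: local_rep_def)

lemma local_rep_has_derivative:
  assumes "smooth_map M N f" "c \<in> charts_at M x" "d \<in> charts_at N (f x)"
  shows "(local_rep c d f has_derivative frechet_derivative (local_rep c d f) (at (snd c x))) (at (snd c x))"
  using assms
  by (intro smooth_on_has_derivative[of "snd c ` (fst c \<inter> f -` fst d)"])
    (auto simp: smooth_map_def charts_at_def)

text \<open>The chain rule for local representatives. Transition maps are local representatives of the identity,
so this one formula also yields that differentials do not depend on the chart and that they send
tangent vectors to tangent vectors.\<close>

lemma frechet_derivative_local_rep_compose:
  assumes M: "complex_manifold M" and N: "complex_manifold N"
    and f: "smooth_map M N f" and g: "smooth_map N K g"
    and c: "c \<in> charts_at M x" and d: "d \<in> charts_at N (f x)" and e: "e \<in> charts_at K (g (f x))"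
  shows "frechet_derivative (local_rep c e (\<lambda>x. g (f x))) (at (snd c x)) w =
    frechet_derivative (local_rep d e g) (at (snd d (f x)))
      (frechet_derivative (local_rep c d f) (at (snd c x)) w)"
proof -
  have at: "c \<in> atlas M" "x \<in> fst c" "d \<in> atlas N" "f x \<in> fst d"
    using c d by (auto simp: charts_at_def)
  let ?D = "frechet_derivative (local_rep d e g) (at (snd d (f x))) \<circ>
    frechet_derivative (local_rep c d f) (at (snd c x))"
  have "(local_rep d e g has_derivative frechet_derivative (local_rep d e g) (at (snd d (f x))))
      (at (local_rep c d f (snd c x)))"
    using local_rep_has_derivative[OF g d e] local_rep_eq[OF M at(1,2)] by metis
  then have "(local_rep d e g \<circ> local_rep c d f has_derivative ?D) (at (snd c x))"
    by (rule diff_chain_at[OF local_rep_has_derivative[OF f c d]])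
  then have "(local_rep c e (\<lambda>x. g (f x)) has_derivative ?D) (at (snd c x))"
  proof (rule has_derivative_transform_within_open)
    show "open (snd c ` (fst c \<inter> f -` fst d))"
      using open_local_rep_domain[OF M N smooth_map_continuous[OF f] at(1,3)] .
    show "snd c x \<in> snd c ` (fst c \<inter> f -` fst d)" using at by auto
    show "(local_rep d e g \<circ> local_rep c d f) z = local_rep c e (\<lambda>x. g (f x)) z"
      if "z \<in> snd c ` (fst c \<inter> f -` fst d)" for z
      using that by (auto simp: local_rep_eq[OF M at(1)] local_rep_eq[OF N at(3)])
  qed
  from frechet_derivative_at[OF this] show ?thesis by (metis comp_apply)
qed

lemma smooth_map_compose:
  assumes M: "complex_manifold M" and N: "complex_manifold N" and K: "complex_manifold K"
    and f: "smooth_map M N f" and g: "smooth_map N K g"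
  shows "smooth_map M K (\<lambda>x. g (f x))"
  unfolding smooth_map_def
proof (intro conjI ballI)
  show cont: "continuous_map (mtop M) (mtop K) (\<lambda>x. g (f x))"
    using continuous_map_compose[OF smooth_map_continuous[OF f] smooth_map_continuous[OF g]]
    by (simp add: o_def)
  fix c e assume c: "c \<in> atlas M" and e: "e \<in> atlas K"
  show "smooth_on (snd c ` (fst c \<inter> (\<lambda>x. g (f x)) -` fst e)) (local_rep c e (\<lambda>x. g (f x)))"
  proof (rule smooth_on_local)
    fix z assume "z \<in> snd c ` (fst c \<inter> (\<lambda>x. g (f x)) -` fst e)"
    then obtain x where x: "x \<in> fst c" "g (f x) \<in> fst e" "z = snd c x" by auto
    have "f x \<in> points N"
      using smooth_map_points[OF f] atlas_subset[OF M c] x(1) by auto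
    then obtain d where d: "d \<in> atlas N" "f x \<in> fst d"
      using N unfolding complex_manifold_def by blast
    let ?T = "snd c ` (fst c \<inter> f -` fst d)" and ?U = "snd d ` (fst d \<inter> g -` fst e)"
    \<comment> \<open>On \<open>?W\<close> the image under \<open>f\<close> stays inside the single chart \<open>d\<close>, so that the composite factors.\<close>
    let ?W = "snd c ` (fst c \<inter> (\<lambda>x. (f x, g (f x))) -` (fst d \<times> fst e))"
    have openW: "open ?W"
      by (intro open_chart_vimage[OF M c, where T = "prod_topology (mtop N) (mtop K)"]
          continuous_map_pairedI smooth_map_continuous[OF f] cont)
        (simp add: openin_prod_Times_iff openin_chart[OF N d(1)] openin_chart[OF K e])
    have openU: "open ?U"
      by (rule open_local_rep_domain[OF N K smooth_map_continuous[OF g] d(1) e])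
    have "smooth_on ?W (\<lambda>z. local_rep d e g (local_rep c d f z))"
    proof (rule smooth_on_compose[OF openW openU])
      show "local_rep c d f ` ?W \<subseteq> ?U"
        by (auto simp: local_rep_eq[OF M c])
      show "smooth_on ?U (local_rep d e g)" using g d(1) e by (simp add: smooth_map_def)
      show "smooth_on ?W (local_rep c d f)"
        by (rule smooth_on_subset[of ?T]) (use f d(1) c in \<open>auto simp: smooth_map_def\<close>)
    qed
    moreover have "local_rep d e g (local_rep c d f z) = local_rep c e (\<lambda>x. g (f x)) z" if "z \<in> ?W" for z
      using that by (auto simp: local_rep_eq[OF M c] local_rep_eq[OF N d(1)])
    ultimately have "smooth_on ?W (local_rep c e (\<lambda>x. g (f x)))"
      using smooth_on_cong[OF openW, of "\<lambda>z. local_rep d e g (local_rep c d f z)"] by simp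
    moreover have "z \<in> ?W" using x d by auto
    ultimately show "\<exists>T. open T \<and> z \<in> T \<and> smooth_on T (local_rep c e (\<lambda>x. g (f x)))"
      using openW by blast
  qed
qed

lemma smooth_map_cong:
  assumes M: "complex_manifold M" and N: "complex_manifold N"
    and f: "smooth_map M N f" and eq: "\<And>x. x \<in> points M \<Longrightarrow> f x = g x"
  shows "smooth_map M N g"
  unfolding smooth_map_def
proof (intro conjI ballI)
  show "continuous_map (mtop M) (mtop N) g"
    using continuous_map_eq[OF smooth_map_continuous[OF f] eq] .
  fix c d assume c: "c \<in> atlas M" and d: "d \<in> atlas N"
  have dom: "fst c \<inter> f -` fst d = fst c \<inter> g -` fst d"
    using eq atlas_subset[OF M c] by auto
  have "open (snd c ` (fst c \<inter> f -` fst d))"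
    by (rule open_local_rep_domain[OF M N smooth_map_continuous[OF f] c d])
  moreover have "local_rep c d f z = local_rep c d g z" if "z \<in> snd c ` (fst c \<inter> f -` fst d)" for z
    using that eq atlas_subset[OF M c] by (auto simp: local_rep_eq[OF M c])
  moreover have "smooth_on (snd c ` (fst c \<inter> f -` fst d)) (local_rep c d f)"
    using f c d by (simp add: smooth_map_def)
  ultimately show "smooth_on (snd c ` (fst c \<inter> g -` fst d)) (local_rep c d g)"
    using smooth_on_cong dom by metis
qed

lemma smooth_map_id:
  assumes "complex_manifold M"
  shows "smooth_map M M (\<lambda>x. x)"
  unfolding smooth_map_def
proof (intro conjI ballI)
  show "continuous_map (mtop M) (mtop M) (\<lambda>x. x)" by (simp add: continuous_map_id[unfolded id_def])
  fix c d assume "c \<in> atlas M" "d \<in> atlas M"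
  then have "smooth_on (snd c ` (fst c \<inter> fst d)) (local_rep c d id)"
    using assms by (simp add: complex_manifold_def holo_on_def)
  then show "smooth_on (snd c ` (fst c \<inter> (\<lambda>x. x) -` fst d)) (local_rep c d (\<lambda>x. x))"
    by (simp add: id_def)
qed

lemma local_rep_const: "local_rep c d (\<lambda>x. a) = (\<lambda>z. snd d a)"
  by (auto simp: local_rep_def)

lemma smooth_map_const:
  assumes "complex_manifold M" "complex_manifold N" "a \<in> points N"
  shows "smooth_map M N (\<lambda>x. a)"
proof -
  have "continuous_map (mtop M) (mtop N) (\<lambda>x. a)" using assms(3) by simp
  then show ?thesis
    using open_local_rep_domain[OF assms(1,2), of "\<lambda>x. a"] unfolding smooth_map_def local_rep_const
    by (blast intro: smooth_on_const)
qed

text \<open>The compatibility condition of a tangent vector, oriented as a terminating rewrite rule.\<close>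

lemma tangent_transition:
  "v \<in> tangent M x \<Longrightarrow> c \<in> charts_at M x \<Longrightarrow> d \<in> charts_at M x \<Longrightarrow>
    frechet_derivative (local_rep c d id) (at (snd c x)) (v c) = v d"
  unfolding tangent_def mem_Collect_eq by metis

lemma tangent_eq_0: "v \<in> tangent M x \<Longrightarrow> c \<notin> charts_at M x \<Longrightarrow> v c = 0"
  unfolding tangent_def by blast

lemma tangentI:
  assumes "\<And>c. c \<notin> charts_at M x \<Longrightarrow> v c = 0"
    and "\<And>c d. c \<in> charts_at M x \<Longrightarrow> d \<in> charts_at M x \<Longrightarrow>
      v d = frechet_derivative (local_rep c d id) (at (snd c x)) (v c)"
  shows "v \<in> tangent M x"
  unfolding tangent_def using assms by blast

text \<open>The differential is defined with a selected chart around \<open>x\<close>. Passing to another chart inserts a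
transition map into the local representative, and its derivative is exactly what relates the
coordinates of \<open>v\<close> in the two charts.\<close>

lemma tderiv_coord:
  assumes M: "complex_manifold M" and f: "smooth_map M N f"
    and v: "v \<in> tangent M x" and c: "c \<in> charts_at M x" and d: "d \<in> charts_at N (f x)"
  shows "tderiv M N f x v d = frechet_derivative (local_rep c d f) (at (snd c x)) (v c)"
proof -
  define c0 where "c0 = (SOME c. c \<in> charts_at M x)"
  have c0: "c0 \<in> charts_at M x" unfolding c0_def using c by (rule someI)
  have "tderiv M N f x v d = frechet_derivative (local_rep c0 d f) (at (snd c0 x)) (v c0)"
    using d by (simp add: tderiv_def Let_def c0_def)
  also have "\<dots> = frechet_derivative (local_rep c d f) (at (snd c x))
      (frechet_derivative (local_rep c0 c (\<lambda>x. x)) (at (snd c0 x)) (v c0))"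
    using frechet_derivative_local_rep_compose[OF M M smooth_map_id[OF M] f c0 c d] .
  also have "frechet_derivative (local_rep c0 c (\<lambda>x. x)) (at (snd c0 x)) (v c0) = v c"
    using tangent_transition[OF v c0 c] unfolding id_def .
  finally show ?thesis .
qed

lemma tderiv_eq_0: "d \<notin> charts_at N (f x) \<Longrightarrow> tderiv M N f x v d = 0"
  by (simp add: tderiv_def Let_def)

lemma tderiv_in_tangent:
  assumes M: "complex_manifold M" and N: "complex_manifold N" and f: "smooth_map M N f"
    and x: "x \<in> points M" and v: "v \<in> tangent M x"
  shows "tderiv M N f x v \<in> tangent N (f x)"
proof -
  obtain c where c: "c \<in> charts_at M x" using charts_at_nonempty[OF M x] by blast
  have "tderiv M N f x v e = frechet_derivative (local_rep d e id) (at (snd d (f x))) (tderiv M N f x v d)"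
    if d: "d \<in> charts_at N (f x)" and e: "e \<in> charts_at N (f x)" for d e
    using frechet_derivative_local_rep_compose[OF M N f smooth_map_id[OF N] c d e, of "v c"]
      tderiv_coord[OF M f v c d] tderiv_coord[OF M f v c e]
    by (simp add: id_def)
  with tderiv_eq_0 show ?thesis by (rule tangentI)
qed

lemma tderiv_compose:
  assumes M: "complex_manifold M" and N: "complex_manifold N" and K: "complex_manifold K"
    and f: "smooth_map M N f" and g: "smooth_map N K g"
    and x: "x \<in> points M" and v: "v \<in> tangent M x"
  shows "tderiv M K (\<lambda>x. g (f x)) x v = tderiv N K g (f x) (tderiv M N f x v)"
proof
  fix e
  obtain c where c: "c \<in> charts_at M x" using charts_at_nonempty[OF M x] by blast
  obtain d where d: "d \<in> charts_at N (f x)"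
    using charts_at_nonempty[OF N smooth_map_points[OF f x]] by blast
  show "tderiv M K (\<lambda>x. g (f x)) x v e = tderiv N K g (f x) (tderiv M N f x v) e"
  proof (cases "e \<in> charts_at K (g (f x))")
    case True
    then show ?thesis
      using frechet_derivative_local_rep_compose[OF M N f g c d True, of "v c"]
        tderiv_coord[OF M smooth_map_compose[OF M N K f g] v c] tderiv_coord[OF M f v c d]
        tderiv_coord[OF N g tderiv_in_tangent[OF M N f x v] d]
      by simp
  qed (simp add: tderiv_eq_0)
qed

text \<open>Maps are total functions with arbitrary values off the manifold; differentials only see the values
on the manifold, because the local representatives agree on the open image of a chart.\<close>

lemma tderiv_cong:
  assumes M: "complex_manifold M" and N: "complex_manifold N" and f: "smooth_map M N f"
    and eq: "\<And>x. x \<in> points M \<Longrightarrow> f x = g x" and x: "x \<in> points M"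
  shows "tderiv M N f x v = tderiv M N g x v"
proof
  fix d
  define c where "c = (SOME c. c \<in> charts_at M x)"
  have c: "c \<in> charts_at M x" unfolding c_def using charts_at_nonempty[OF M x] by (rule someI_ex)
  then have cM: "c \<in> atlas M" "x \<in> fst c" by (auto simp: charts_at_def)
  show "tderiv M N f x v d = tderiv M N g x v d"
  proof (cases "d \<in> charts_at N (f x)")
    case True
    have "open (snd c ` fst c)" using M cM(1) by (simp add: complex_manifold_def is_chart_def)
    moreover have "local_rep c d f z = local_rep c d g z" if "z \<in> snd c ` fst c" for z
      using that eq atlas_subset[OF M cM(1)] by (auto simp: local_rep_eq[OF M cM(1)])
    moreover have "local_rep c d f differentiable at (snd c x)"
      using local_rep_has_derivative[OF f c True] by (auto simp: differentiable_def)
    ultimately have "frechet_derivative (local_rep c d f) (at (snd c x)) =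
        frechet_derivative (local_rep c d g) (at (snd c x))"
      using cM(2) by (intro frechet_derivative_transform_within_open[of _ _ "snd c ` fst c"]) auto
    then show ?thesis using True eq[OF x] by (simp add: tderiv_def Let_def c_def)
  qed (use eq[OF x] in \<open>simp add: tderiv_eq_0\<close>)
qed

lemma tderiv_id:
  assumes M: "complex_manifold M" and x: "x \<in> points M" and v: "v \<in> tangent M x"
  shows "tderiv M M (\<lambda>x. x) x v = v"
proof
  fix d
  obtain c where c: "c \<in> charts_at M x" using charts_at_nonempty[OF M x] by blast
  show "tderiv M M (\<lambda>x. x) x v d = v d"
    using tderiv_coord[OF M smooth_map_id[OF M] v c, of d] tangent_transition[OF v c, of d]
    by (cases "d \<in> charts_at M x") (simp_all add: tangent_eq_0[OF v] tderiv_eq_0 id_def)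
qed

lemma tderiv_const: "tderiv M N (\<lambda>x. a) x v = 0"
  by (auto simp: tderiv_def Let_def local_rep_const)

lemma linear_transition:
  assumes "complex_manifold M" "c \<in> charts_at M x" "d \<in> charts_at M x"
  shows "linear (frechet_derivative (local_rep c d id) (at (snd c x)))"
  using has_derivative_linear[OF local_rep_has_derivative[OF smooth_map_id[OF assms(1)] assms(2,3)]]
  by (simp add: id_def)

lemma tangent_0:
  assumes "complex_manifold M"
  shows "0 \<in> tangent M x"
  by (rule tangentI) (simp_all add: linear_0[OF linear_transition[OF assms]])

lemma tangent_add:
  assumes "complex_manifold M" "u \<in> tangent M x" "v \<in> tangent M x"
  shows "u + v \<in> tangent M x"
  by (rule tangentI)
    (simp_all add: tangent_eq_0[OF assms(2)] tangent_eq_0[OF assms(3)]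
      linear_add[OF linear_transition[OF assms(1)]] tangent_transition[OF assms(2)] tangent_transition[OF assms(3)])

lemma tderiv_add:
  assumes M: "complex_manifold M" and N: "complex_manifold N" and f: "smooth_map M N f"
    and x: "x \<in> points M" and u: "u \<in> tangent M x" and v: "v \<in> tangent M x"
  shows "tderiv M N f x (u + v) = tderiv M N f x u + tderiv M N f x v"
proof
  fix d
  obtain c where c: "c \<in> charts_at M x" using charts_at_nonempty[OF M x] by blast
  show "tderiv M N f x (u + v) d = (tderiv M N f x u + tderiv M N f x v) d"
  proof (cases "d \<in> charts_at N (f x)")
    case d: True
    show ?thesis
      using linear_add[OF has_derivative_linear[OF local_rep_has_derivative[OF f c d]], of "u c" "v c"]
      by (simp add: tderiv_coord[OF M f _ c d] u v tangent_add[OF M u v])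
  qed (simp add: tderiv_eq_0)
qed

text \<open>The tangent spaces are complex because transition maps have complex linear derivatives.\<close>

lemma tangent_i:
  assumes M: "complex_manifold M" and v: "v \<in> tangent M x"
  shows "\<i> *\<^sub>C v \<in> tangent M x"
proof (rule tangentI)
  fix c d assume cd: "c \<in> charts_at M x" "d \<in> charts_at M x"
  then have "holo_on (snd c ` (fst c \<inter> fst d)) (local_rep c d id)" "snd c x \<in> snd c ` (fst c \<inter> fst d)"
    using M by (auto simp: charts_at_def complex_manifold_def)
  then have "frechet_derivative (local_rep c d id) (at (snd c x)) (\<i> *\<^sub>C v c) =
      \<i> *\<^sub>C frechet_derivative (local_rep c d id) (at (snd c x)) (v c)"
    unfolding holo_on_def by blast
  then show "(\<i> *\<^sub>C v) d = frechet_derivative (local_rep c d id) (at (snd c x)) ((\<i> *\<^sub>C v) c)"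
    unfolding tangent_transition[OF v cd] scaleC_fun_def by (rule sym)
qed (simp add: scaleC_fun_def tangent_eq_0[OF v])

section \<open>Product manifolds and holomorphic maps\<close>

definition prod_chart :: "('a, 'v) chart \<Rightarrow> ('b, 'w) chart \<Rightarrow> ('a \<times> 'b, 'v \<times> 'w) chart" where
  "prod_chart c d = (fst c \<times> fst d, map_prod (snd c) (snd d))"

lemma fst_prod_chart [simp]: "fst (prod_chart c d) = fst c \<times> fst d"
  and snd_prod_chart [simp]: "snd (prod_chart c d) (x, y) = (snd c x, snd d y)"
  by (simp_all add: prod_chart_def)

lemma snd_prod_chart_image: "snd (prod_chart c d) ` (A \<times> B) = (snd c ` A) \<times> (snd d ` B)"
  by (auto simp: prod_chart_def)

lemma mtop_prod [simp]: "mtop (prod_mfd M N) = prod_topology (mtop M) (mtop N)"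
  by (simp add: prod_mfd_def)

lemma atlas_prod: "atlas (prod_mfd M N) = {prod_chart c d | c d. c \<in> atlas M \<and> d \<in> atlas N}"
  by (simp add: prod_mfd_def prod_chart_def)

lemma charts_at_prod:
  "e \<in> charts_at (prod_mfd M N) p \<longleftrightarrow>
    (\<exists>c\<in>charts_at M (fst p). \<exists>d\<in>charts_at N (snd p). e = prod_chart c d)"
proof (cases p)
  case (Pair x y)
  then show ?thesis
    unfolding charts_at_def atlas_prod mem_Collect_eq Bex_def by (metis fst_prod_chart mem_Sigma_iff fst_conv snd_conv)
qed

lemma prod_chart_charts_at:
  "c \<in> charts_at M (fst p) \<Longrightarrow> d \<in> charts_at N (snd p) \<Longrightarrow> prod_chart c d \<in> charts_at (prod_mfd M N) p"
  by (auto simp: charts_at_prod)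

lemma is_chart_prod_chart:
  fixes c :: "('a, 'v::real_normed_vector) chart" and d :: "('b, 'w::real_normed_vector) chart"
  assumes "is_chart T c" "is_chart U d"
  shows "is_chart (prod_topology T U) (prod_chart c d)"
proof -
  obtain c' where c': "homeomorphic_maps (subtopology T (fst c)) (top_of_set (snd c ` fst c)) (snd c) c'"
    using assms(1) unfolding is_chart_def homeomorphic_map_maps by blast
  obtain d' where d': "homeomorphic_maps (subtopology U (fst d)) (top_of_set (snd d ` fst d)) (snd d) d'"
    using assms(2) unfolding is_chart_def homeomorphic_map_maps by blast
  have "homeomorphic_maps (prod_topology (subtopology T (fst c)) (subtopology U (fst d)))
      (prod_topology (top_of_set (snd c ` fst c)) (top_of_set (snd d ` fst d)))
      (\<lambda>(x, y). (snd c x, snd d y)) (\<lambda>(x, y). (c' x, d' y))"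
    using c' d' homeomorphic_maps_prod by blast
  moreover have "prod_topology (top_of_set (snd c ` fst c)) (top_of_set (snd d ` fst d)) =
      top_of_set ((snd c ` fst c) \<times> (snd d ` fst d))"
    by (simp flip: subtopology_Times euclidean_product_topology)
  moreover have "(\<lambda>(x, y). (snd c x, snd d y)) = snd (prod_chart c d)"
    by (auto simp: prod_chart_def)
  ultimately have "homeomorphic_map (subtopology (prod_topology T U) (fst c \<times> fst d))
      (top_of_set ((snd c ` fst c) \<times> (snd d ` fst d))) (snd (prod_chart c d))"
    unfolding homeomorphic_map_maps subtopology_Times by auto
  then show ?thesis
    using assms by (auto simp: is_chart_def snd_prod_chart_image openin_prod_Times_iff open_Times)
qed

lemma complex_manifold_prod:
  fixes M :: "('a, 'm::complex_fd_space) manifold" and N :: "('b, 'n::complex_fd_space) manifold"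
  assumes M: "complex_manifold M" and N: "complex_manifold N"
  shows "complex_manifold (prod_mfd M N)"
  unfolding complex_manifold_def
proof (intro conjI ballI)
  show "Hausdorff_space (mtop (prod_mfd M N))"
    using M N by (simp add: complex_manifold_def Hausdorff_space_prod_topology)
  show "(\<Union>e\<in>atlas (prod_mfd M N). fst e) = points (prod_mfd M N)"
  proof (intro equalityI subsetI)
    fix p assume "p \<in> (\<Union>e\<in>atlas (prod_mfd M N). fst e)"
    then obtain c d where "c \<in> atlas M" "d \<in> atlas N" "p \<in> fst c \<times> fst d"
      unfolding atlas_prod by fastforce
    then show "p \<in> points (prod_mfd M N)"
      using atlas_subset[OF M, of c] atlas_subset[OF N, of d] by auto
  next
    fix p assume "p \<in> points (prod_mfd M N)"
    then obtain c d where "c \<in> charts_at M (fst p)" "d \<in> charts_at N (snd p)"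
      using charts_at_nonempty[OF M] charts_at_nonempty[OF N] by fastforce
    then have "prod_chart c d \<in> charts_at (prod_mfd M N) p" by (rule prod_chart_charts_at)
    then show "p \<in> (\<Union>e\<in>atlas (prod_mfd M N). fst e)" unfolding charts_at_def by blast
  qed
  show chart: "is_chart (mtop (prod_mfd M N)) e" if "e \<in> atlas (prod_mfd M N)" for e
    using that M N by (auto simp: atlas_prod complex_manifold_def intro: is_chart_prod_chart)
  fix e e' assume ee: "e \<in> atlas (prod_mfd M N)" "e' \<in> atlas (prod_mfd M N)"
  then obtain c d c' d' where e: "e = prod_chart c d" "c \<in> atlas M" "d \<in> atlas N"
    and e': "e' = prod_chart c' d'" "c' \<in> atlas M" "d' \<in> atlas N"
    unfolding atlas_prod by blast
  let ?S = "snd c ` (fst c \<inter> fst c')" and ?T = "snd d ` (fst d \<inter> fst d')"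
  have dom: "snd e ` (fst e \<inter> fst e') = ?S \<times> ?T"
    by (simp add: e(1) e'(1) Times_Int_Times snd_prod_chart_image)
  have "open ?S" "open ?T"
    using is_chart_open[OF complex_manifold_is_chart[OF M e(2)] openin_chart[OF M e'(2)]]
      is_chart_open[OF complex_manifold_is_chart[OF N e(3)] openin_chart[OF N e'(3)]] .
  moreover have "holo_on ?S (local_rep c c' id)" "holo_on ?T (local_rep d d' id)"
    using M N e e' by (auto simp: complex_manifold_def)
  ultimately have "holo_on (?S \<times> ?T) (map_prod (local_rep c c' id) (local_rep d d' id))"
    by (intro holo_on_map_prod)
  then have "holo_on (?S \<times> ?T) (local_rep e e' id)"
  proof (rule holo_on_cong[rotated 2])
    show "open (?S \<times> ?T)" using \<open>open ?S\<close> \<open>open ?T\<close> by (rule open_Times)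
    fix z assume "z \<in> ?S \<times> ?T"
    then obtain x y where xy: "x \<in> fst c" "y \<in> fst d" "z = (snd c x, snd d y)" by auto
    have "chart_inv e z = (x, y)"
      using chart_inv_chart[OF chart[OF ee(1)], of "(x, y)"] xy e(1) by simp
    then show "map_prod (local_rep c c' id) (local_rep d d' id) z = local_rep e e' id z"
      using xy local_rep_eq[OF M e(2) xy(1), of c' id] local_rep_eq[OF N e(3) xy(2), of d' id]
      by (simp add: local_rep_def[of e] e'(1))
  qed
  then show "holo_on (snd e ` (fst e \<inter> fst e')) (local_rep e e' id)" by (simp add: dom)
qed

text \<open>In product charts the projection to \<open>M\<close> is the linear projection followed by a transition map
of \<open>M\<close>.\<close>

lemma smooth_map_fst:
  fixes M :: "('a, 'm::complex_fd_space) manifold" and N :: "('b, 'n::complex_fd_space) manifold"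
  assumes M: "complex_manifold M" and N: "complex_manifold N"
  shows "smooth_map (prod_mfd M N) M fst"
  unfolding smooth_map_def
proof (intro conjI ballI)
  show "continuous_map (mtop (prod_mfd M N)) (mtop M) fst" by (simp add: continuous_map_fst)
  fix e c' assume ee: "e \<in> atlas (prod_mfd M N)" and c': "c' \<in> atlas M"
  obtain c d where e: "e = prod_chart c d" "c \<in> atlas M" "d \<in> atlas N"
    using ee unfolding atlas_prod by blast
  let ?S = "snd c ` (fst c \<inter> fst c')" and ?T = "snd d ` fst d"
  have "fst e \<inter> fst -` fst c' = (fst c \<inter> fst c') \<times> fst d"
    unfolding e(1) by auto
  then have dom: "snd e ` (fst e \<inter> fst -` fst c') = ?S \<times> ?T"
    by (simp add: e(1) snd_prod_chart_image)
  have "open ?S"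
    using is_chart_open[OF complex_manifold_is_chart[OF M e(2)] openin_chart[OF M c']] .
  moreover have "open ?T"
    using N e(3) by (auto simp: complex_manifold_def is_chart_def)
  ultimately have op: "open (?S \<times> ?T)" by (rule open_Times)
  have "smooth_on ?S (local_rep c c' id)"
    using M e(2) c' by (simp add: complex_manifold_def holo_on_def)
  then have "smooth_on (?S \<times> ?T) (\<lambda>z. local_rep c c' id (fst z))"
    by (rule smooth_on_compose[OF op \<open>open ?S\<close>, rotated])
      (auto intro: smooth_on_bounded_linear op bounded_linear_fst)
  moreover have "local_rep c c' id (fst z) = local_rep e c' fst z" if "z \<in> ?S \<times> ?T" for z
    using that e c' local_rep_eq[OF complex_manifold_prod[OF M N] ee, of _ c' fst]
    by (auto simp: local_rep_eq[OF M e(2)])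
  ultimately show "smooth_on (snd e ` (fst e \<inter> fst -` fst c')) (local_rep e c' fst)"
    using smooth_on_cong[OF op] unfolding dom by metis
qed

lemma smooth_map_snd:
  fixes M :: "('a, 'm::complex_fd_space) manifold" and N :: "('b, 'n::complex_fd_space) manifold"
  assumes M: "complex_manifold M" and N: "complex_manifold N"
  shows "smooth_map (prod_mfd M N) N snd"
  unfolding smooth_map_def
proof (intro conjI ballI)
  show "continuous_map (mtop (prod_mfd M N)) (mtop N) snd" by (simp add: continuous_map_snd)
  fix e d' assume ee: "e \<in> atlas (prod_mfd M N)" and d': "d' \<in> atlas N"
  obtain c d where e: "e = prod_chart c d" "c \<in> atlas M" "d \<in> atlas N"
    using ee unfolding atlas_prod by blast
  let ?S = "snd c ` fst c" and ?T = "snd d ` (fst d \<inter> fst d')"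
  have "fst e \<inter> snd -` fst d' = fst c \<times> (fst d \<inter> fst d')"
    unfolding e(1) by auto
  then have dom: "snd e ` (fst e \<inter> snd -` fst d') = ?S \<times> ?T"
    by (simp add: e(1) snd_prod_chart_image)
  have "open ?T"
    using is_chart_open[OF complex_manifold_is_chart[OF N e(3)] openin_chart[OF N d']] .
  moreover have "open ?S"
    using M e(2) by (auto simp: complex_manifold_def is_chart_def)
  ultimately have op: "open (?S \<times> ?T)" by (intro open_Times)
  have "smooth_on ?T (local_rep d d' id)"
    using N e(3) d' by (simp add: complex_manifold_def holo_on_def)
  then have "smooth_on (?S \<times> ?T) (\<lambda>z. local_rep d d' id (snd z))"
    by (rule smooth_on_compose[OF op \<open>open ?T\<close>, rotated])
      (auto intro: smooth_on_bounded_linear op bounded_linear_snd)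
  moreover have "local_rep d d' id (snd z) = local_rep e d' snd z" if "z \<in> ?S \<times> ?T" for z
    using that e d' local_rep_eq[OF complex_manifold_prod[OF M N] ee, of _ d' snd]
    by (auto simp: local_rep_eq[OF N e(3)])
  ultimately show "smooth_on (snd e ` (fst e \<inter> snd -` fst d')) (local_rep e d' snd)"
    using smooth_on_cong[OF op] unfolding dom by metis
qed

lemma local_rep_Pair:
  "local_rep c (prod_chart d e) (\<lambda>x. (f x, g x)) = (\<lambda>z. (local_rep c d f z, local_rep c e g z))"
  by (auto simp: local_rep_def)

lemma smooth_map_Pair:
  fixes M :: "('a, 'm::complex_fd_space) manifold" and N :: "('b, 'n::complex_fd_space) manifold"
    and K :: "('c, 'k::complex_fd_space) manifold"
  assumes M: "complex_manifold M" and N: "complex_manifold N" and K: "complex_manifold K"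
    and f: "smooth_map M N f" and g: "smooth_map M K g"
  shows "smooth_map M (prod_mfd N K) (\<lambda>x. (f x, g x))"
  unfolding smooth_map_def
proof (intro conjI ballI)
  show cont: "continuous_map (mtop M) (mtop (prod_mfd N K)) (\<lambda>x. (f x, g x))"
    using f g by (simp add: smooth_map_def continuous_map_pairedI)
  fix c e' assume c: "c \<in> atlas M" and ee: "e' \<in> atlas (prod_mfd N K)"
  obtain d e where e: "e' = prod_chart d e" "d \<in> atlas N" "e \<in> atlas K"
    using ee unfolding atlas_prod by blast
  have "open (snd c ` (fst c \<inter> (\<lambda>x. (f x, g x)) -` fst e'))"
    by (rule open_local_rep_domain[OF M complex_manifold_prod[OF N K] cont c ee])
  then show "smooth_on (snd c ` (fst c \<inter> (\<lambda>x. (f x, g x)) -` fst e')) (local_rep c e' (\<lambda>x. (f x, g x)))"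
    unfolding e(1) local_rep_Pair
  proof (rule smooth_on_Pair)
    show "smooth_on (snd c ` (fst c \<inter> (\<lambda>x. (f x, g x)) -` fst (prod_chart d e))) (local_rep c d f)"
      by (rule smooth_on_subset[of "snd c ` (fst c \<inter> f -` fst d)"])
        (use f c e in \<open>auto simp: smooth_map_def\<close>)
    show "smooth_on (snd c ` (fst c \<inter> (\<lambda>x. (f x, g x)) -` fst (prod_chart d e))) (local_rep c e g)"
      by (rule smooth_on_subset[of "snd c ` (fst c \<inter> g -` fst e)"])
        (use g c e in \<open>auto simp: smooth_map_def\<close>)
  qed
qed

lemma tderiv_Pair:
  fixes M :: "('a, 'm::complex_fd_space) manifold" and N :: "('b, 'n::complex_fd_space) manifold"
    and K :: "('c, 'k::complex_fd_space) manifold"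
  assumes M: "complex_manifold M"
    and f: "smooth_map M N f" and g: "smooth_map M K g" and x: "x \<in> points M"
    and d: "d \<in> charts_at N (f x)" and e: "e \<in> charts_at K (g x)"
  shows "tderiv M (prod_mfd N K) (\<lambda>x. (f x, g x)) x v (prod_chart d e) =
    (tderiv M N f x v d, tderiv M K g x v e)"
proof -
  define c where "c = (SOME c. c \<in> charts_at M x)"
  have c: "c \<in> charts_at M x" unfolding c_def using charts_at_nonempty[OF M x] by (rule someI_ex)
  have "frechet_derivative (\<lambda>z. (local_rep c d f z, local_rep c e g z)) (at (snd c x)) =
      (\<lambda>w. (frechet_derivative (local_rep c d f) (at (snd c x)) w,
        frechet_derivative (local_rep c e g) (at (snd c x)) w))"
    by (rule frechet_derivative_at[symmetric])
      (intro has_derivative_Pair local_rep_has_derivative[OF f c d] local_rep_has_derivative[OF g c e])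
  moreover have "prod_chart d e \<in> charts_at (prod_mfd N K) (f x, g x)"
    using d e by (intro prod_chart_charts_at) simp_all
  ultimately show ?thesis
    using d e unfolding tderiv_def Let_def c_def[symmetric] local_rep_Pair by simp
qed

text \<open>A tangent vector of a product is determined by its two projections: the identity of the product is
the pair of the two projection maps, so its differential, computed in product charts, recovers the
vector from the differentials of the projections.\<close>

lemma tangent_prod_eqI:
  fixes M :: "('a, 'm::complex_fd_space) manifold" and N :: "('b, 'n::complex_fd_space) manifold"
  assumes M: "complex_manifold M" and N: "complex_manifold N" and p: "p \<in> points (prod_mfd M N)"
    and s: "s \<in> tangent (prod_mfd M N) p" and t: "t \<in> tangent (prod_mfd M N) p"
    and "tderiv (prod_mfd M N) M fst p s = tderiv (prod_mfd M N) M fst p t"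
    and "tderiv (prod_mfd M N) N snd p s = tderiv (prod_mfd M N) N snd p t"
  shows "s = t"
proof
  fix e
  let ?P = "prod_mfd M N"
  have P: "complex_manifold ?P" using M N by (rule complex_manifold_prod)
  show "s e = t e"
  proof (cases "e \<in> charts_at ?P p")
    case True
    then obtain c d where e: "c \<in> charts_at M (fst p)" "d \<in> charts_at N (snd p)" "e = prod_chart c d"
      by (auto simp: charts_at_prod)
    have "r e = (tderiv ?P M fst p r c, tderiv ?P N snd p r d)" if "r \<in> tangent ?P p" for r
      using tderiv_Pair[OF P smooth_map_fst[OF M N] smooth_map_snd[OF M N] p e(1,2), of r]
        tderiv_id[OF P p that] by (simp add: e(3))
    from this[OF s] this[OF t] assms(6,7) show ?thesis by simp
  qed (simp add: tangent_eq_0[OF s] tangent_eq_0[OF t])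
qed

text \<open>The partial derivative rule, together with the fact that \<^const>\<open>tpair\<close> inverts the pair of
projections. The latter are again partial derivatives: each projection restricts to the identity on
one factor and to a constant on the other.\<close>

lemma tpair_facts:
  fixes M :: "('a, 'm::complex_fd_space) manifold" and N :: "('b, 'n::complex_fd_space) manifold"
  assumes M: "complex_manifold M" and N: "complex_manifold N" and x: "x \<in> points M" and y: "y \<in> points N"
    and v: "v \<in> tangent M x" and w: "w \<in> tangent N y"
  shows tpair_in_tangent: "tpair M N (x, y) v w \<in> tangent (prod_mfd M N) (x, y)"
    and tderiv_tpair: "complex_manifold K \<Longrightarrow> smooth_map (prod_mfd M N) K h \<Longrightarrow>
      tderiv (prod_mfd M N) K h (x, y) (tpair M N (x, y) v w) =
      tderiv M K (\<lambda>x. h (x, y)) x v + tderiv N K (\<lambda>y. h (x, y)) y w"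
    and tderiv_fst_tpair: "tderiv (prod_mfd M N) M fst (x, y) (tpair M N (x, y) v w) = v"
    and tderiv_snd_tpair: "tderiv (prod_mfd M N) N snd (x, y) (tpair M N (x, y) v w) = w"
proof -
  let ?P = "prod_mfd M N"
  have P: "complex_manifold ?P" and p: "(x, y) \<in> points ?P"
    using M N x y by (auto intro: complex_manifold_prod)
  have i: "smooth_map M ?P (\<lambda>x. (x, y))"
    by (intro smooth_map_Pair smooth_map_id smooth_map_const M N y)
  have j: "smooth_map N ?P (\<lambda>y. (x, y))"
    by (intro smooth_map_Pair smooth_map_id smooth_map_const M N x)
  have iv: "tderiv M ?P (\<lambda>x. (x, y)) x v \<in> tangent ?P (x, y)"
    using tderiv_in_tangent[OF M P i x v] .
  have jw: "tderiv N ?P (\<lambda>y. (x, y)) y w \<in> tangent ?P (x, y)"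
    using tderiv_in_tangent[OF N P j y w] .
  show "tpair M N (x, y) v w \<in> tangent ?P (x, y)"
    using tangent_add[OF P iv jw] by (simp add: tpair_def)
  show rule: "tderiv ?P K h (x, y) (tpair M N (x, y) v w) =
      tderiv M K (\<lambda>x. h (x, y)) x v + tderiv N K (\<lambda>y. h (x, y)) y w"
    if K: "complex_manifold K" and h: "smooth_map ?P K h" for K :: "('c, 'k::complex_fd_space) manifold" and h
    using tderiv_add[OF P K h p iv jw] tderiv_compose[OF M P K i h x v] tderiv_compose[OF N P K j h y w]
    by (simp add: tpair_def)
  show "tderiv ?P M fst (x, y) (tpair M N (x, y) v w) = v"
  proof -
    have "tderiv ?P M fst (x, y) (tpair M N (x, y) v w) =
        tderiv M M (\<lambda>x. fst (x, y)) x v + tderiv N M (\<lambda>y. fst (x, y)) y w"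
      using tderiv_add[OF P M smooth_map_fst[OF M N] p iv jw]
        tderiv_compose[OF M P M i smooth_map_fst[OF M N] x v]
        tderiv_compose[OF N P M j smooth_map_fst[OF M N] y w]
      by (simp add: tpair_def)
    then show ?thesis by (simp add: tderiv_id[OF M x v] tderiv_const)
  qed
  show "tderiv ?P N snd (x, y) (tpair M N (x, y) v w) = w"
  proof -
    have "tderiv ?P N snd (x, y) (tpair M N (x, y) v w) =
        tderiv M N (\<lambda>x. snd (x, y)) x v + tderiv N N (\<lambda>y. snd (x, y)) y w"
      using tderiv_add[OF P N smooth_map_snd[OF M N] p iv jw]
        tderiv_compose[OF M P N i smooth_map_snd[OF M N] x v]
        tderiv_compose[OF N P N j smooth_map_snd[OF M N] y w]
      by (simp add: tpair_def)
    then show ?thesis by (simp add: tderiv_id[OF N y w] tderiv_const)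
  qed
qed

lemma holo_map_smooth: "holo_map M N f \<Longrightarrow> smooth_map M N f"
  by (simp add: holo_map_def)

lemma holo_map_tderiv_i:
  "holo_map M N f \<Longrightarrow> x \<in> points M \<Longrightarrow> v \<in> tangent M x \<Longrightarrow>
    tderiv M N f x (\<i> *\<^sub>C v) = \<i> *\<^sub>C tderiv M N f x v"
  by (simp add: holo_map_def)

lemma holo_map_id: "complex_manifold M \<Longrightarrow> holo_map M M (\<lambda>x. x)"
  by (simp add: holo_map_def smooth_map_id tderiv_id tangent_i)

lemma holo_map_const:
  "complex_manifold M \<Longrightarrow> complex_manifold N \<Longrightarrow> a \<in> points N \<Longrightarrow> holo_map M N (\<lambda>x. a)"
  by (auto simp: holo_map_def smooth_map_const tderiv_const scaleC_fun_def)

lemma holo_map_Pair: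
  fixes M :: "('a, 'm::complex_fd_space) manifold" and N :: "('b, 'n::complex_fd_space) manifold"
    and K :: "('c, 'k::complex_fd_space) manifold"
  assumes M: "complex_manifold M" and N: "complex_manifold N" and K: "complex_manifold K"
    and f: "holo_map M N f" and g: "holo_map M K g"
  shows "holo_map M (prod_mfd N K) (\<lambda>x. (f x, g x))"
  unfolding holo_map_def
proof (intro conjI ballI)
  show "smooth_map M (prod_mfd N K) (\<lambda>x. (f x, g x))"
    by (intro smooth_map_Pair M N K holo_map_smooth f g)
  fix x v assume x: "x \<in> points M" and v: "v \<in> tangent M x"
  show "tderiv M (prod_mfd N K) (\<lambda>x. (f x, g x)) x (\<i> *\<^sub>C v) =
      \<i> *\<^sub>C tderiv M (prod_mfd N K) (\<lambda>x. (f x, g x)) x v"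
  proof
    fix e'
    show "tderiv M (prod_mfd N K) (\<lambda>x. (f x, g x)) x (\<i> *\<^sub>C v) e' =
        (\<i> *\<^sub>C tderiv M (prod_mfd N K) (\<lambda>x. (f x, g x)) x v) e'"
    proof (cases "e' \<in> charts_at (prod_mfd N K) (f x, g x)")
      case True
      then obtain d e where e: "d \<in> charts_at N (f x)" "e \<in> charts_at K (g x)" "e' = prod_chart d e"
        by (auto simp: charts_at_prod)
      show ?thesis
        unfolding e(3) scaleC_fun_def
          tderiv_Pair[OF M holo_map_smooth[OF f] holo_map_smooth[OF g] x e(1,2)]
        using holo_map_tderiv_i[OF f x v] holo_map_tderiv_i[OF g x v]
        by (simp add: scaleC_prod_def scaleC_fun_def)
    qed (simp add: tderiv_eq_0 scaleC_fun_def)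
  qed
qed

lemma holo_map_compose:
  assumes M: "complex_manifold M" and N: "complex_manifold N" and K: "complex_manifold K"
    and f: "holo_map M N f" and g: "holo_map N K g"
  shows "holo_map M K (\<lambda>x. g (f x))"
  unfolding holo_map_def
proof (intro conjI ballI)
  note sm = holo_map_smooth[OF f] holo_map_smooth[OF g]
  show "smooth_map M K (\<lambda>x. g (f x))" by (intro smooth_map_compose[OF M N K] sm)
  fix x v assume x: "x \<in> points M" and v: "v \<in> tangent M x"
  show "tderiv M K (\<lambda>x. g (f x)) x (\<i> *\<^sub>C v) = \<i> *\<^sub>C tderiv M K (\<lambda>x. g (f x)) x v"
    using holo_map_tderiv_i[OF f x v]
      holo_map_tderiv_i[OF g smooth_map_points[OF sm(1) x] tderiv_in_tangent[OF M N sm(1) x v]]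
    by (simp add: tderiv_compose[OF M N K sm x v] tderiv_compose[OF M N K sm x tangent_i[OF M v]])
qed

section \<open>Complex linear algebra of tangent vectors\<close>

lemma scaleC_fun_add: "a *\<^sub>C (f + g) = a *\<^sub>C f + a *\<^sub>C (g :: 'a \<Rightarrow> 'b::complex_fd_space)"
  by (simp add: scaleC_fun_def fun_eq_iff scaleC_add_right)

lemma scaleC_2i_fun: "(2 * \<i>) *\<^sub>C f = \<i> *\<^sub>C f + \<i> *\<^sub>C (f :: 'a \<Rightarrow> 'b::complex_fd_space)"
proof -
  have "2 * \<i> = \<i> + \<i>" by simp
  then show ?thesis unfolding scaleC_fun_def by (simp only: scaleC_add_left) (simp add: fun_eq_iff)
qed

lemma tangent_2i: "complex_manifold M \<Longrightarrow> v \<in> tangent M x \<Longrightarrow> (2 * \<i>) *\<^sub>C v \<in> tangent M x"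
  unfolding scaleC_2i_fun by (intro tangent_add tangent_i)

lemma holo_map_tderiv_2i:
  assumes "complex_manifold M" "complex_manifold N" "holo_map M N f" "x \<in> points M" "v \<in> tangent M x"
  shows "tderiv M N f x ((2 * \<i>) *\<^sub>C v) = (2 * \<i>) *\<^sub>C tderiv M N f x v"
  unfolding scaleC_2i_fun
  using assms by (simp add: tderiv_add tangent_i holo_map_smooth holo_map_tderiv_i)

text \<open>The equation on the left is the condition for an equivalence that arises from the complex structures;
\<open>a\<close> and \<open>a'\<close> are the values of a form on \<open>v\<close> and \<open>\<i> v\<close>. Dividing by \<open>2 \<i>\<close> makes the
projection to the component of type (0,1) appear.\<close>

lemma solve_for_type01_component:
  fixes a a' b w :: "'b \<Rightarrow> 'a::complex_fd_space"
  shows "a' + (2 * \<i>) *\<^sub>C w = \<i> *\<^sub>C a + (2 * \<i>) *\<^sub>C b \<longleftrightarrow>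
    w = (1 / 2) *\<^sub>C (a + \<i> *\<^sub>C a') + b"
proof -
  have "a' + (2 * \<i>) *\<^sub>C w = \<i> *\<^sub>C a + (2 * \<i>) *\<^sub>C b \<longleftrightarrow> w = (1 / 2) *\<^sub>C (a + \<i> *\<^sub>C a') + b"
    for a a' b w :: 'a
  proof
    assume "a' + (2 * \<i>) *\<^sub>C w = \<i> *\<^sub>C a + (2 * \<i>) *\<^sub>C b"
    then have "(- \<i> / 2) *\<^sub>C (a' + (2 * \<i>) *\<^sub>C w) = (- \<i> / 2) *\<^sub>C (\<i> *\<^sub>C a + (2 * \<i>) *\<^sub>C b)"
      by simp
    then have "(- \<i> / 2) *\<^sub>C a' + w = (1 / 2) *\<^sub>C a + b"
      by (simp add: scaleC_add_right scaleC_scaleC)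
    then have "w = (1 / 2) *\<^sub>C a - (- \<i> / 2) *\<^sub>C a' + b"
      by (simp add: algebra_simps eq_diff_eq)
    then show "w = (1 / 2) *\<^sub>C (a + \<i> *\<^sub>C a') + b"
      by (simp add: scaleC_add_right scaleC_scaleC flip: scaleC_minus_left)
  next
    assume w: "w = (1 / 2) *\<^sub>C (a + \<i> *\<^sub>C a') + b"
    have "(2 * \<i>) *\<^sub>C w = \<i> *\<^sub>C a - a' + (2 * \<i>) *\<^sub>C b"
      unfolding w by (simp add: scaleC_add_right scaleC_scaleC scaleC_minus_left)
    then show "a' + (2 * \<i>) *\<^sub>C w = \<i> *\<^sub>C a + (2 * \<i>) *\<^sub>C b" by simp
  qed
  then show ?thesis by (simp add: fun_eq_iff scaleC_fun_def)
qed

section \<open>Holomorphic bundle maps\<close>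

lemma bundle_holo_cong:
  fixes P :: "('p, 'u::complex_fd_space, 'a, 'g) principal_bundle"
    and Q :: "('q, 'w::complex_fd_space, 'a, 'g) principal_bundle"
  assumes P: "complex_manifold (total P)" and Q: "complex_manifold (total Q)"
    and eq: "\<And>p. p \<in> points (total P) \<Longrightarrow> \<Phi> p = \<Psi> p" and holo: "bundle_holo P Q \<Phi>"
  shows "bundle_holo P Q \<Psi>"
proof -
  have \<Phi>: "smooth_map (total P) (total Q) \<Phi>" using holo by (simp add: bundle_holo_def)
  show ?thesis
    using holo smooth_map_cong[OF P Q \<Phi> eq] tderiv_cong[OF P Q \<Phi> eq] eq
    unfolding bundle_holo_def by simp
qed

text \<open>Inverting \<open>d\<Phi> \<circ> I = I' \<circ> d\<Phi>\<close> gives \<open>d\<Psi> \<circ> I' = I \<circ> d\<Psi>\<close>. The assumption that \<open>I\<close> preserves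
tangent spaces is what allows the chain rule to be applied to \<open>I t\<close>.\<close>

lemma bundle_holo_inverse:
  fixes P :: "('p, 'u::complex_fd_space, 'a, 'g) principal_bundle"
    and Q :: "('q, 'w::complex_fd_space, 'a, 'g) principal_bundle"
  assumes P: "complex_manifold (total P)" and Q: "complex_manifold (total Q)"
    and holo: "bundle_holo P Q \<Phi>" and \<Psi>: "smooth_map (total Q) (total P) \<Psi>"
    and \<Psi>\<Phi>: "\<And>p. p \<in> points (total P) \<Longrightarrow> \<Psi> (\<Phi> p) = p"
    and \<Phi>\<Psi>: "\<And>q. q \<in> points (total Q) \<Longrightarrow> \<Phi> (\<Psi> q) = q"
    and J: "\<And>p t. p \<in> points (total P) \<Longrightarrow> t \<in> tangent (total P) p \<Longrightarrow> cstruct P p t \<in> tangent (total P) p"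
  shows "bundle_holo Q P \<Psi>"
  unfolding bundle_holo_def
proof (intro conjI ballI \<Psi>)
  have \<Phi>: "smooth_map (total P) (total Q) \<Phi>" using holo by (simp add: bundle_holo_def)
  fix q s assume q: "q \<in> points (total Q)" and s: "s \<in> tangent (total Q) q"
  let ?p = "\<Psi> q" and ?t = "tderiv (total Q) (total P) \<Psi> q s"
  have p: "?p \<in> points (total P)" by (rule smooth_map_points[OF \<Psi> q])
  have t: "?t \<in> tangent (total P) ?p" by (rule tderiv_in_tangent[OF Q P \<Psi> q s])
  have s_eq: "tderiv (total P) (total Q) \<Phi> ?p ?t = s"
    using tderiv_compose[OF Q P Q \<Psi> \<Phi> q s] tderiv_id[OF Q q s]
      tderiv_cong[OF Q Q smooth_map_compose[OF Q P Q \<Psi> \<Phi>] \<Phi>\<Psi> q]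
    by simp
  have "tderiv (total Q) (total P) \<Psi> q (cstruct Q q s) =
      tderiv (total Q) (total P) \<Psi> (\<Phi> ?p) (cstruct Q (\<Phi> ?p) (tderiv (total P) (total Q) \<Phi> ?p ?t))"
    by (simp add: s_eq \<Phi>\<Psi>[OF q])
  also have "\<dots> = tderiv (total Q) (total P) \<Psi> (\<Phi> ?p) (tderiv (total P) (total Q) \<Phi> ?p (cstruct P ?p ?t))"
    using holo p t unfolding bundle_holo_def by metis
  also have "\<dots> = tderiv (total P) (total P) (\<lambda>p. \<Psi> (\<Phi> p)) ?p (cstruct P ?p ?t)"
    by (rule tderiv_compose[OF P Q P \<Phi> \<Psi> p J[OF p t], symmetric])
  also have "\<dots> = tderiv (total P) (total P) (\<lambda>p. p) ?p (cstruct P ?p ?t)"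
    by (rule tderiv_cong[OF P P smooth_map_compose[OF P Q P \<Phi> \<Psi>] \<Psi>\<Phi> p])
  also have "\<dots> = cstruct P ?p ?t"
    by (rule tderiv_id[OF P p J[OF p t]])
  finally show "tderiv (total Q) (total P) \<Psi> q (cstruct Q q s) = cstruct P ?p ?t" .
qed

section \<open>Translations and the adjoint action of a complex Lie group\<close>

context
  fixes G :: "('g, 'n::complex_fd_space) lie_group" (structure)
  assumes G: "complex_lie_group G"
begin

interpretation group G
  using G by (simp add: complex_lie_group_def)

lemma mfd_lie_group: "complex_manifold (mfd G)"
  and points_lie_group: "points (mfd G) = carrier G"
  using G by (simp_all add: complex_lie_group_def)

lemma holo_map_mult:
  fixes K :: "('c, 'k::complex_fd_space) manifold"
  assumes K: "complex_manifold K" and f: "holo_map K (mfd G) f" and h: "holo_map K (mfd G) h"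
  shows "holo_map K (mfd G) (\<lambda>x. f x \<otimes> h x)"
proof -
  have "holo_map (prod_mfd (mfd G) (mfd G)) (mfd G) (\<lambda>(g, h). g \<otimes> h)"
    using G by (simp add: complex_lie_group_def)
  from holo_map_compose[OF K complex_manifold_prod[OF mfd_lie_group mfd_lie_group] mfd_lie_group
      holo_map_Pair[OF K mfd_lie_group mfd_lie_group f h] this]
  show ?thesis by simp
qed

lemma smooth_map_mult:
  fixes K :: "('c, 'k::complex_fd_space) manifold"
  assumes K: "complex_manifold K" and f: "smooth_map K (mfd G) f" and h: "smooth_map K (mfd G) h"
  shows "smooth_map K (mfd G) (\<lambda>x. f x \<otimes> h x)"
proof -
  have "smooth_map (prod_mfd (mfd G) (mfd G)) (mfd G) (\<lambda>(g, h). g \<otimes> h)"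
    using G by (simp add: complex_lie_group_def holo_map_def)
  from smooth_map_compose[OF K complex_manifold_prod[OF mfd_lie_group mfd_lie_group] mfd_lie_group
      smooth_map_Pair[OF K mfd_lie_group mfd_lie_group f h] this]
  show ?thesis by simp
qed

lemma smooth_map_m_inv:
  assumes "complex_manifold K" "smooth_map K (mfd G) f"
  shows "smooth_map K (mfd G) (\<lambda>x. inv (f x))"
  using smooth_map_compose[OF assms(1) mfd_lie_group mfd_lie_group assms(2)] G
  by (simp add: complex_lie_group_def holo_map_def)

lemma holo_map_left_translation: "g \<in> carrier G \<Longrightarrow> holo_map (mfd G) (mfd G) (\<lambda>k. g \<otimes> k)"
  and holo_map_right_translation: "g \<in> carrier G \<Longrightarrow> holo_map (mfd G) (mfd G) (\<lambda>k. k \<otimes> g)"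
  by (auto intro!: holo_map_mult holo_map_id holo_map_const mfd_lie_group simp: points_lie_group)

lemmas smooth_map_left_translation = holo_map_smooth[OF holo_map_left_translation]
lemmas smooth_map_right_translation = holo_map_smooth[OF holo_map_right_translation]

lemma ltrans_tangent:
  "g \<in> carrier G \<Longrightarrow> h \<in> carrier G \<Longrightarrow> w \<in> tangent (mfd G) h \<Longrightarrow> ltrans G g h w \<in> tangent (mfd G) (g \<otimes> h)"
  unfolding ltrans_def
  by (rule tderiv_in_tangent[OF mfd_lie_group mfd_lie_group smooth_map_left_translation])
    (simp_all add: points_lie_group)

lemma rtrans_tangent:
  "g \<in> carrier G \<Longrightarrow> h \<in> carrier G \<Longrightarrow> w \<in> tangent (mfd G) h \<Longrightarrow> rtrans G g h w \<in> tangent (mfd G) (h \<otimes> g)"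
  unfolding rtrans_def
  by (rule tderiv_in_tangent[OF mfd_lie_group mfd_lie_group smooth_map_right_translation])
    (simp_all add: points_lie_group)

lemma rtrans_lie_algebra:
  "g \<in> carrier G \<Longrightarrow> \<xi> \<in> lie_algebra G \<Longrightarrow> rtrans G g \<one> \<xi> \<in> tangent (mfd G) g"
  using rtrans_tangent[of g \<one> \<xi>] by (simp add: lie_algebra_def)

lemma ltrans_lie_algebra:
  "g \<in> carrier G \<Longrightarrow> \<xi> \<in> lie_algebra G \<Longrightarrow> ltrans G g \<one> \<xi> \<in> tangent (mfd G) g"
  using ltrans_tangent[of g \<one> \<xi>] by (simp add: lie_algebra_def)

lemma ltrans_linear:
  assumes "g \<in> carrier G" "h \<in> carrier G" "u \<in> tangent (mfd G) h" "v \<in> tangent (mfd G) h"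
  shows ltrans_add: "ltrans G g h (u + v) = ltrans G g h u + ltrans G g h v"
    and ltrans_i: "ltrans G g h (\<i> *\<^sub>C v) = \<i> *\<^sub>C ltrans G g h v"
    and ltrans_2i: "ltrans G g h ((2 * \<i>) *\<^sub>C v) = (2 * \<i>) *\<^sub>C ltrans G g h v"
  unfolding ltrans_def
  using assms tderiv_add[OF mfd_lie_group mfd_lie_group smooth_map_left_translation[OF assms(1)]]
    holo_map_tderiv_i[OF holo_map_left_translation[OF assms(1)]]
    holo_map_tderiv_2i[OF mfd_lie_group mfd_lie_group holo_map_left_translation[OF assms(1)]]
  by (auto simp: points_lie_group)

lemma rtrans_linear:
  assumes "g \<in> carrier G" "h \<in> carrier G" "u \<in> tangent (mfd G) h" "v \<in> tangent (mfd G) h"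
  shows rtrans_add: "rtrans G g h (u + v) = rtrans G g h u + rtrans G g h v"
    and rtrans_i: "rtrans G g h (\<i> *\<^sub>C v) = \<i> *\<^sub>C rtrans G g h v"
    and rtrans_2i: "rtrans G g h ((2 * \<i>) *\<^sub>C v) = (2 * \<i>) *\<^sub>C rtrans G g h v"
  unfolding rtrans_def
  using assms tderiv_add[OF mfd_lie_group mfd_lie_group smooth_map_right_translation[OF assms(1)]]
    holo_map_tderiv_i[OF holo_map_right_translation[OF assms(1)]]
    holo_map_tderiv_2i[OF mfd_lie_group mfd_lie_group holo_map_right_translation[OF assms(1)]]
  by (auto simp: points_lie_group)

text \<open>The next three rules are the differentials of the identities \<open>g (h k) = (g h) k\<close>,
\<open>(k h) g = k (h g)\<close> and \<open>g (k h) = (g k) h\<close>; all computations with translates of tangent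
vectors reduce to them.\<close>

lemma ltrans_ltrans:
  assumes "g \<in> carrier G" "h \<in> carrier G" "k \<in> carrier G" "w \<in> tangent (mfd G) k"
  shows "ltrans G g (h \<otimes> k) (ltrans G h k w) = ltrans G (g \<otimes> h) k w"
proof -
  note sm = smooth_map_left_translation[OF assms(2)] smooth_map_left_translation[OF assms(1)]
  have "ltrans G g (h \<otimes> k) (ltrans G h k w) = tderiv (mfd G) (mfd G) (\<lambda>k. g \<otimes> (h \<otimes> k)) k w"
    unfolding ltrans_def using assms
    by (subst tderiv_compose[OF mfd_lie_group mfd_lie_group mfd_lie_group sm]) (simp_all add: points_lie_group)
  also have "\<dots> = ltrans G (g \<otimes> h) k w"
    unfolding ltrans_def using assms
    by (intro tderiv_cong mfd_lie_group smooth_map_compose[OF _ _ _ sm]) (simp_all add: points_lie_group m_assoc)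
  finally show ?thesis .
qed

lemma rtrans_rtrans:
  assumes "g \<in> carrier G" "h \<in> carrier G" "k \<in> carrier G" "w \<in> tangent (mfd G) k"
  shows "rtrans G g (k \<otimes> h) (rtrans G h k w) = rtrans G (h \<otimes> g) k w"
proof -
  note sm = smooth_map_right_translation[OF assms(2)] smooth_map_right_translation[OF assms(1)]
  have "rtrans G g (k \<otimes> h) (rtrans G h k w) = tderiv (mfd G) (mfd G) (\<lambda>k. k \<otimes> h \<otimes> g) k w"
    unfolding rtrans_def using assms
    by (subst tderiv_compose[OF mfd_lie_group mfd_lie_group mfd_lie_group sm]) (simp_all add: points_lie_group)
  also have "\<dots> = rtrans G (h \<otimes> g) k w"
    unfolding rtrans_def using assms
    by (intro tderiv_cong mfd_lie_group smooth_map_compose[OF _ _ _ sm]) (simp_all add: points_lie_group m_assoc)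
  finally show ?thesis .
qed

lemma ltrans_rtrans_commute:
  assumes "g \<in> carrier G" "h \<in> carrier G" "k \<in> carrier G" "w \<in> tangent (mfd G) k"
  shows "ltrans G g (k \<otimes> h) (rtrans G h k w) = rtrans G h (g \<otimes> k) (ltrans G g k w)"
proof -
  note l = smooth_map_left_translation[OF assms(1)] and r = smooth_map_right_translation[OF assms(2)]
  have "ltrans G g (k \<otimes> h) (rtrans G h k w) = tderiv (mfd G) (mfd G) (\<lambda>k. g \<otimes> (k \<otimes> h)) k w"
    unfolding rtrans_def ltrans_def using assms
    by (subst tderiv_compose[OF mfd_lie_group mfd_lie_group mfd_lie_group r l]) (simp_all add: points_lie_group)
  also have "\<dots> = tderiv (mfd G) (mfd G) (\<lambda>k. g \<otimes> k \<otimes> h) k w"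
    using assms
    by (intro tderiv_cong mfd_lie_group smooth_map_compose[OF _ _ _ r l]) (simp_all add: points_lie_group m_assoc)
  also have "\<dots> = rtrans G h (g \<otimes> k) (ltrans G g k w)"
    unfolding rtrans_def ltrans_def using assms
    by (subst tderiv_compose[OF mfd_lie_group mfd_lie_group mfd_lie_group l r]) (simp_all add: points_lie_group)
  finally show ?thesis .
qed

lemma ltrans_one: "k \<in> carrier G \<Longrightarrow> w \<in> tangent (mfd G) k \<Longrightarrow> ltrans G \<one> k w = w"
  unfolding ltrans_def
  using tderiv_cong[OF mfd_lie_group mfd_lie_group smooth_map_id[OF mfd_lie_group], of "\<lambda>k. \<one> \<otimes> k" k w]
    tderiv_id[OF mfd_lie_group, of k w]
  by (simp add: points_lie_group)

lemma rtrans_one: "k \<in> carrier G \<Longrightarrow> w \<in> tangent (mfd G) k \<Longrightarrow> rtrans G \<one> k w = w"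
  unfolding rtrans_def
  using tderiv_cong[OF mfd_lie_group mfd_lie_group smooth_map_id[OF mfd_lie_group], of "\<lambda>k. k \<otimes> \<one>" k w]
    tderiv_id[OF mfd_lie_group, of k w]
  by (simp add: points_lie_group)

lemma ltrans_inv_ltrans:
  "g \<in> carrier G \<Longrightarrow> \<xi> \<in> lie_algebra G \<Longrightarrow> ltrans G (inv g) g (ltrans G g \<one> \<xi>) = \<xi>"
  using ltrans_ltrans[of "inv g" g \<one> \<xi>] ltrans_one[of \<one> \<xi>] by (simp add: lie_algebra_def)

lemma ltrans_ltrans_inv:
  "g \<in> carrier G \<Longrightarrow> w \<in> tangent (mfd G) g \<Longrightarrow> ltrans G g \<one> (ltrans G (inv g) g w) = w"
  using ltrans_ltrans[of g "inv g" g w] ltrans_one[of g w] by simp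

lemma ltrans_inv_lie_algebra:
  "g \<in> carrier G \<Longrightarrow> w \<in> tangent (mfd G) g \<Longrightarrow> ltrans G (inv g) g w \<in> lie_algebra G"
  using ltrans_tangent[of "inv g" g w] by (simp add: lie_algebra_def)

lemma rtrans_inject:
  assumes "g \<in> carrier G" "h \<in> carrier G" "u \<in> tangent (mfd G) h" "v \<in> tangent (mfd G) h"
  shows "rtrans G g h u = rtrans G g h v \<longleftrightarrow> u = v"
proof -
  have "rtrans G (inv g) (h \<otimes> g) (rtrans G g h w) = w" if w: "w \<in> tangent (mfd G) h" for w
  proof -
    have "rtrans G (inv g) (h \<otimes> g) (rtrans G g h w) = rtrans G (g \<otimes> inv g) h w"
      by (rule rtrans_rtrans) (use assms(1,2) w in auto)
    also have "\<dots> = w"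
      using assms(1,2) w by (simp add: rtrans_one)
    finally show ?thesis .
  qed
  then have "inj_on (rtrans G g h) (tangent (mfd G) h)"
    by (rule inj_on_inverseI[where g = "rtrans G (inv g) (h \<otimes> g)"])
  then show ?thesis
    using assms(3,4) by (rule inj_on_eq_iff)
qed

text \<open>Since \<open>Ad(g)\<close> is the differential of left translation by \<open>g\<close> followed by right translation by
\<open>g\<^sup>-\<^sup>1\<close>, its inverse sends \<open>\<xi>\<close> to the left translate by \<open>g\<^sup>-\<^sup>1\<close> of \<open>\<xi>.g\<close>.\<close>

lemma inv_into_Ad:
  assumes g: "g \<in> carrier G" and \<xi>: "\<xi> \<in> lie_algebra G"
  shows "inv_into (lie_algebra G) (Ad G g) \<xi> = ltrans G (inv g) g (rtrans G g \<one> \<xi>)"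
proof -
  have Ad: "Ad G g w = rtrans G (inv g) g (ltrans G g \<one> w)" if "w \<in> lie_algebra G" for w
    using tderiv_compose[OF mfd_lie_group mfd_lie_group mfd_lie_group smooth_map_left_translation[OF g]
        smooth_map_right_translation[of "inv g"], of \<one> w] that g
    by (simp add: Ad_def rtrans_def ltrans_def lie_algebra_def points_lie_group)
  note mem = ltrans_inv_lie_algebra[OF g rtrans_lie_algebra[OF g \<xi>]]
  have "inj_on (Ad G g) (lie_algebra G)"
  proof (rule inj_onI)
    fix u v assume u: "u \<in> lie_algebra G" and v: "v \<in> lie_algebra G" and "Ad G g u = Ad G g v"
    then have "ltrans G g \<one> u = ltrans G g \<one> v"
      using g by (simp add: Ad rtrans_inject ltrans_lie_algebra)
    moreover have "inj_on (ltrans G g \<one>) (lie_algebra G)"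
      using ltrans_inv_ltrans[OF g] by (rule inj_on_inverseI[where g = "ltrans G (inv g) g"])
    ultimately show "u = v" using u v by (auto dest: inj_onD)
  qed
  moreover have "Ad G g (ltrans G (inv g) g (rtrans G g \<one> \<xi>)) = \<xi>"
    using g \<xi> rtrans_rtrans[of "inv g" g \<one> \<xi>] rtrans_one[of \<one> \<xi>]
    by (simp add: Ad[OF mem] ltrans_ltrans_inv rtrans_lie_algebra) (simp add: lie_algebra_def)
  ultimately show ?thesis using mem by (intro inv_into_f_eq)
qed

section \<open>Gauge transformations of the trivial bundle\<close>

lemma Omega01_lie_algebra:
  "\<omega> \<in> Omega01 M G \<Longrightarrow> x \<in> points M \<Longrightarrow> v \<in> tangent M x \<Longrightarrow> \<omega> x v \<in> lie_algebra G"
  by (simp add: Omega01_def is_lie_form_def)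

text \<open>Both entries of the pair that defines \<open>I\<^sub>\<omega>\<close> are tangent vectors, the second one because \<open>\<omega>\<close>
takes values in the Lie algebra and right translation by \<open>g\<close> carries these to \<open>g\<close>; hence the two
projections return the entries.\<close>

lemma I_form_facts:
  fixes M :: "('a, 'm::complex_fd_space) manifold" and x :: 'a and g :: 'g
    and t :: "('a \<times> 'g, 'm \<times> 'n) tvec"
  defines "P \<equiv> prod_mfd M (mfd G)"
  assumes M: "complex_manifold M" and \<omega>: "\<omega> \<in> Omega01 M G"
    and x: "x \<in> points M" and g: "g \<in> carrier G" and t: "t \<in> tangent P (x, g)"
  shows I_form_tangent: "I_form M G \<omega> (x, g) t \<in> tangent P (x, g)"
    and tderiv_fst_I_form: "tderiv P M fst (x, g) (I_form M G \<omega> (x, g) t) = \<i> *\<^sub>C tderiv P M fst (x, g) t"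
    and tderiv_snd_I_form: "tderiv P (mfd G) snd (x, g) (I_form M G \<omega> (x, g) t) =
      \<i> *\<^sub>C tderiv P (mfd G) snd (x, g) t + (2 * \<i>) *\<^sub>C rtrans G g \<one> (\<omega> x (tderiv P M fst (x, g) t))"
proof -
  let ?v = "tderiv P M fst (x, g) t" and ?w = "tderiv P (mfd G) snd (x, g) t"
  have P: "complex_manifold P" and p: "(x, g) \<in> points P" and gN: "g \<in> points (mfd G)"
    using M mfd_lie_group x g by (auto simp: P_def points_lie_group intro: complex_manifold_prod)
  have v: "?v \<in> tangent M x"
    using tderiv_in_tangent[OF P M _ p t, of fst] smooth_map_fst[OF M mfd_lie_group] by (simp add: P_def)
  have w: "?w \<in> tangent (mfd G) g"
    using tderiv_in_tangent[OF P mfd_lie_group _ p t, of snd] smooth_map_snd[OF M mfd_lie_group]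
    by (simp add: P_def)
  have iv: "\<i> *\<^sub>C ?v \<in> tangent M x" using tangent_i[OF M v] .
  have iw: "\<i> *\<^sub>C ?w + (2 * \<i>) *\<^sub>C rtrans G g \<one> (\<omega> x ?v) \<in> tangent (mfd G) g"
    by (intro tangent_add tangent_i tangent_2i mfd_lie_group w rtrans_lie_algebra g
        Omega01_lie_algebra[OF \<omega> x v])
  have I: "I_form M G \<omega> (x, g) t =
      tpair M (mfd G) (x, g) (\<i> *\<^sub>C ?v) (\<i> *\<^sub>C ?w + (2 * \<i>) *\<^sub>C rtrans G g \<one> (\<omega> x ?v))"
    by (simp add: I_form_def Let_def P_def)
  show "I_form M G \<omega> (x, g) t \<in> tangent P (x, g)"
    unfolding I P_def by (rule tpair_in_tangent[OF M mfd_lie_group x gN]) (use iv iw in \<open>simp_all add: P_def\<close>)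
  show "tderiv P M fst (x, g) (I_form M G \<omega> (x, g) t) = \<i> *\<^sub>C ?v"
    unfolding I using tderiv_fst_tpair[OF M mfd_lie_group x gN iv iw] by (simp add: P_def)
  show "tderiv P (mfd G) snd (x, g) (I_form M G \<omega> (x, g) t) =
      \<i> *\<^sub>C ?w + (2 * \<i>) *\<^sub>C rtrans G g \<one> (\<omega> x ?v)"
    unfolding I using tderiv_snd_tpair[OF M mfd_lie_group x gN iv iw] by (simp add: P_def)
qed

lemma smooth_map_gauge:
  fixes M :: "('a, 'm::complex_fd_space) manifold"
  assumes M: "complex_manifold M" and f: "smooth_map M (mfd G) f"
  shows smooth_map_gauge_snd: "smooth_map (prod_mfd M (mfd G)) (mfd G) (\<lambda>p. f (fst p) \<otimes> snd p)"
    and smooth_map_gauge_pair: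
      "smooth_map (prod_mfd M (mfd G)) (prod_mfd M (mfd G)) (\<lambda>p. (fst p, f (fst p) \<otimes> snd p))"
proof -
  have P: "complex_manifold (prod_mfd M (mfd G))" by (rule complex_manifold_prod[OF M mfd_lie_group])
  show A: "smooth_map (prod_mfd M (mfd G)) (mfd G) (\<lambda>p. f (fst p) \<otimes> snd p)"
    by (intro smooth_map_mult smooth_map_compose[OF P M mfd_lie_group _ f] P smooth_map_fst smooth_map_snd
        M mfd_lie_group)
  show "smooth_map (prod_mfd M (mfd G)) (prod_mfd M (mfd G)) (\<lambda>p. (fst p, f (fst p) \<otimes> snd p))"
    by (intro smooth_map_Pair A P smooth_map_fst M mfd_lie_group)
qed

text \<open>The Leibniz rule for the product \<open>f(x) g\<close>: its partial differentials are those of a right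
translation after \<open>f\<close> and of a left translation.\<close>

lemma tderiv_gauge_snd:
  fixes M :: "('a, 'm::complex_fd_space) manifold" and t :: "('a \<times> 'g, 'm \<times> 'n) tvec"
  defines "P \<equiv> prod_mfd M (mfd G)"
  assumes M: "complex_manifold M" and f: "smooth_map M (mfd G) f"
    and x: "x \<in> points M" and g: "g \<in> carrier G" and t: "t \<in> tangent P (x, g)"
  shows "tderiv P (mfd G) (\<lambda>p. f (fst p) \<otimes> snd p) (x, g) t =
    rtrans G g (f x) (tderiv M (mfd G) f x (tderiv P M fst (x, g) t)) +
    ltrans G (f x) g (tderiv P (mfd G) snd (x, g) t)"
proof -
  let ?v = "tderiv P M fst (x, g) t" and ?w = "tderiv P (mfd G) snd (x, g) t"
  note N = mfd_lie_group
  have P: "complex_manifold P" and p: "(x, g) \<in> points P" and gN: "g \<in> points (mfd G)"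
    using M N x g by (auto simp: P_def points_lie_group intro: complex_manifold_prod)
  have v: "?v \<in> tangent M x"
    using tderiv_in_tangent[OF P M _ p t, of fst] smooth_map_fst[OF M N] by (simp add: P_def)
  have w: "?w \<in> tangent (mfd G) g"
    using tderiv_in_tangent[OF P N _ p t, of snd] smooth_map_snd[OF M N]
    by (simp add: P_def)
  have fx: "f x \<in> carrier G" using smooth_map_points[OF f x] by (simp add: points_lie_group)
  have t_eq: "t = tpair M (mfd G) (x, g) ?v ?w"
  proof (rule tangent_prod_eqI[OF M N])
    show "(x, g) \<in> points (prod_mfd M (mfd G))" using p by (simp add: P_def)
    show "t \<in> tangent (prod_mfd M (mfd G)) (x, g)" using t by (simp add: P_def)
    show "tpair M (mfd G) (x, g) ?v ?w \<in> tangent (prod_mfd M (mfd G)) (x, g)"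
      using tpair_in_tangent[OF M N x gN v w] .
  qed (simp_all only: P_def tderiv_fst_tpair[OF M N x gN v[unfolded P_def] w[unfolded P_def]]
      tderiv_snd_tpair[OF M N x gN v[unfolded P_def] w[unfolded P_def]])
  have "tderiv P (mfd G) (\<lambda>p. f (fst p) \<otimes> snd p) (x, g) (tpair M (mfd G) (x, g) ?v ?w) =
      tderiv M (mfd G) (\<lambda>x. f x \<otimes> g) x ?v + tderiv (mfd G) (mfd G) (\<lambda>k. f x \<otimes> k) g ?w"
    using tderiv_tpair[OF M N x gN v w N smooth_map_gauge_snd[OF M f]] by (simp add: P_def)
  also have "tderiv M (mfd G) (\<lambda>x. f x \<otimes> g) x ?v = rtrans G g (f x) (tderiv M (mfd G) f x ?v)"
    unfolding rtrans_def by (rule tderiv_compose[OF M N N f smooth_map_right_translation[OF g] x v])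
  finally show ?thesis
    unfolding ltrans_def t_eq[symmetric] .
qed

text \<open>The heart of the matter. Write a tangent vector at \<open>(x, g)\<close> as \<open>(v, w)\<close>. The differential of
\<open>(x, g) \<mapsto> (x, f(x) g)\<close> sends it to \<open>(v, df(v).g + f.w)\<close>. Applying \<open>I\<^sub>\<omega>\<close> before or after, the
components along \<open>M\<close> agree, and those along \<open>G\<close> are

\<open>df(\<i> v).g + \<i> f.w + 2 \<i> f.\<omega>\<^sub>1(v).g\<close> and \<open>\<i> df(v).g + \<i> f.w + 2 \<i> \<omega>\<^sub>2(v).f.g\<close>.

The terms with \<open>w\<close> cancel, the right translation by \<open>g\<close> is injective, and a left translation by
\<open>f\<^sup>-\<^sup>1\<close> turns the remaining equation into an equation in the Lie algebra, which is solved for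
\<open>\<omega>\<^sub>1(v)\<close>. In particular the condition depends neither on \<open>w\<close> nor on \<open>g\<close>.\<close>

lemma gauge_intertwines_iff:
  fixes M :: "('a, 'm::complex_fd_space) manifold" and t :: "('a \<times> 'g, 'm \<times> 'n) tvec"
  defines "P \<equiv> prod_mfd M (mfd G)"
  assumes M: "complex_manifold M" and \<omega>1: "\<omega>1 \<in> Omega01 M G" and \<omega>2: "\<omega>2 \<in> Omega01 M G"
    and f: "smooth_map M (mfd G) f"
    and x: "x \<in> points M" and g: "g \<in> carrier G" and t: "t \<in> tangent P (x, g)"
  defines "\<Phi> \<equiv> \<lambda>p. (fst p, f (fst p) \<otimes> snd p)" and "v \<equiv> tderiv P M fst (x, g) t"
  shows "tderiv P P \<Phi> (x, g) (I_form M G \<omega>1 (x, g) t) =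
      I_form M G \<omega>2 (\<Phi> (x, g)) (tderiv P P \<Phi> (x, g) t) \<longleftrightarrow>
    \<omega>1 x v = left_log_dbar M G f x v + Ad_inv_form G f \<omega>2 x v"
proof -
  note N = mfd_lie_group
  let ?N = "mfd G" and ?df = "tderiv M (mfd G) f x" and ?w = "tderiv P (mfd G) snd (x, g) t"
  have P: "complex_manifold P" and p: "(x, g) \<in> points P"
    using M N x g by (auto simp: P_def points_lie_group intro: complex_manifold_prod)
  have fst: "smooth_map P M fst" and snd: "smooth_map P ?N snd"
    unfolding P_def by (intro smooth_map_fst smooth_map_snd M N)+
  have v: "v \<in> tangent M x" and w: "?w \<in> tangent ?N g"
    using tderiv_in_tangent[OF P M fst p t] tderiv_in_tangent[OF P N snd p t] by (simp_all add: v_def)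
  have fx: "f x \<in> carrier G" using smooth_map_points[OF f x] by (simp add: points_lie_group)
  have fxg: "f x \<otimes> g \<in> carrier G" using fx g by simp
  have \<Phi>: "smooth_map P P \<Phi>" unfolding P_def \<Phi>_def by (rule smooth_map_gauge_pair[OF M f])
  have \<Phi>p: "\<Phi> (x, g) = (x, f x \<otimes> g)" "\<Phi> (x, g) \<in> points P"
    using smooth_map_points[OF \<Phi> p] by (simp_all add: \<Phi>_def)
  have dv: "?df v \<in> tangent ?N (f x)" and div: "?df (\<i> *\<^sub>C v) \<in> tangent ?N (f x)"
    by (intro tderiv_in_tangent[OF M N f x] v tangent_i[OF M])+
  define \<xi>1 where "\<xi>1 = \<omega>1 x v"
  define \<xi>2 where "\<xi>2 = \<omega>2 x v"
  have \<xi>1: "\<xi>1 \<in> lie_algebra G" and \<xi>2: "\<xi>2 \<in> lie_algebra G"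
    unfolding \<xi>1_def \<xi>2_def by (intro Omega01_lie_algebra[OF _ x v] \<omega>1 \<omega>2)+
  have one: "\<xi>1 \<in> tangent ?N \<one>" "\<xi>2 \<in> tangent ?N \<one>"
    using \<xi>1 \<xi>2 by (simp_all add: lie_algebra_def)
  have d\<Phi>: "tderiv P P \<Phi> (x, g) s \<in> tangent P (x, f x \<otimes> g)"
      "tderiv P M fst (x, f x \<otimes> g) (tderiv P P \<Phi> (x, g) s) = tderiv P M fst (x, g) s"
      "tderiv P ?N snd (x, f x \<otimes> g) (tderiv P P \<Phi> (x, g) s) =
        rtrans G g (f x) (?df (tderiv P M fst (x, g) s)) + ltrans G (f x) g (tderiv P ?N snd (x, g) s)"
    if s: "s \<in> tangent P (x, g)" for s
  proof -
    show "tderiv P P \<Phi> (x, g) s \<in> tangent P (x, f x \<otimes> g)"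
      using tderiv_in_tangent[OF P P \<Phi> p s] by (simp add: \<Phi>p)
    show "tderiv P M fst (x, f x \<otimes> g) (tderiv P P \<Phi> (x, g) s) = tderiv P M fst (x, g) s"
      using tderiv_compose[OF P P M \<Phi> fst p s] by (simp add: \<Phi>_def)
    show "tderiv P ?N snd (x, f x \<otimes> g) (tderiv P P \<Phi> (x, g) s) =
        rtrans G g (f x) (?df (tderiv P M fst (x, g) s)) + ltrans G (f x) g (tderiv P ?N snd (x, g) s)"
      using tderiv_compose[OF P P N \<Phi> snd p s] tderiv_gauge_snd[OF M f x g s[unfolded P_def]]
      by (simp add: \<Phi>_def P_def)
  qed
  note I1 = I_form_facts[OF M \<omega>1 x g t[unfolded P_def], folded P_def, folded v_def, folded \<xi>1_def]
  note I2 = I_form_facts[OF M \<omega>2 x fxg d\<Phi>(1)[OF t, unfolded P_def], folded P_def,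
      unfolded d\<Phi>(2)[OF t], folded v_def, folded \<xi>2_def, unfolded d\<Phi>(3)[OF t], folded v_def]
  have Lw: "ltrans G (f x) g ?w \<in> tangent ?N (f x \<otimes> g)" by (rule ltrans_tangent[OF fx g w])
  have rg1: "rtrans G g \<one> \<xi>1 \<in> tangent ?N g" by (rule rtrans_lie_algebra[OF g \<xi>1])
  \<comment> \<open>\<open>X\<close> and \<open>Y\<close> are the two components along \<open>G\<close> without the common term \<open>\<i> f.w\<close> and before the
    right translation by \<open>g\<close>.\<close>
  define X where "X = ?df (\<i> *\<^sub>C v) + (2 * \<i>) *\<^sub>C ltrans G (f x) \<one> \<xi>1"
  define Y where "Y = \<i> *\<^sub>C ?df v + (2 * \<i>) *\<^sub>C rtrans G (f x) \<one> \<xi>2"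
  have l1: "ltrans G (f x) \<one> \<xi>1 \<in> tangent ?N (f x)" and r2: "rtrans G (f x) \<one> \<xi>2 \<in> tangent ?N (f x)"
    using ltrans_lie_algebra[OF fx \<xi>1] rtrans_lie_algebra[OF fx \<xi>2] .
  have X: "X \<in> tangent ?N (f x)" and Y: "Y \<in> tangent ?N (f x)"
    unfolding X_def Y_def by (intro tangent_add tangent_i tangent_2i N div dv l1 r2)+
  have RX: "rtrans G g (f x) X = rtrans G g (f x) (?df (\<i> *\<^sub>C v)) +
      (2 * \<i>) *\<^sub>C ltrans G (f x) g (rtrans G g \<one> \<xi>1)"
    using rtrans_add[OF g fx div tangent_2i[OF N l1]] rtrans_2i[OF g fx l1 l1]
      ltrans_rtrans_commute[OF fx g one_closed one(1)] fx g
    by (simp add: X_def)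
  have RY: "rtrans G g (f x) Y = \<i> *\<^sub>C rtrans G g (f x) (?df v) +
      (2 * \<i>) *\<^sub>C rtrans G (f x \<otimes> g) \<one> \<xi>2"
    using rtrans_add[OF g fx tangent_i[OF N dv] tangent_2i[OF N r2]] rtrans_2i[OF g fx r2 r2]
      rtrans_i[OF g fx dv dv] rtrans_rtrans[OF g fx one_closed one(2)] fx g
    by (simp add: Y_def)
  have lhs: "tderiv P ?N snd (x, f x \<otimes> g) (tderiv P P \<Phi> (x, g) (I_form M G \<omega>1 (x, g) t)) =
      rtrans G g (f x) X + \<i> *\<^sub>C ltrans G (f x) g ?w"
    unfolding d\<Phi>(3)[OF I1(1)] I1(2,3) RX
    using ltrans_add[OF fx g tangent_i[OF N w] tangent_2i[OF N rg1]] ltrans_i[OF fx g w w]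
      ltrans_2i[OF fx g rg1 rg1]
    by (simp add: add_ac)
  have rhs: "tderiv P ?N snd (x, f x \<otimes> g) (I_form M G \<omega>2 (x, f x \<otimes> g) (tderiv P P \<Phi> (x, g) t)) =
      rtrans G g (f x) Y + \<i> *\<^sub>C ltrans G (f x) g ?w"
    unfolding I2(3) RY by (simp add: scaleC_fun_add add_ac)
  have "tderiv P P \<Phi> (x, g) (I_form M G \<omega>1 (x, g) t) =
      I_form M G \<omega>2 (x, f x \<otimes> g) (tderiv P P \<Phi> (x, g) t) \<longleftrightarrow> X = Y" (is "?A = ?B \<longleftrightarrow> _")
  proof
    assume "?A = ?B"
    then have "rtrans G g (f x) X + \<i> *\<^sub>C ltrans G (f x) g ?w = rtrans G g (f x) Y + \<i> *\<^sub>C ltrans G (f x) g ?w"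
      using lhs rhs by metis
    then show "X = Y" using rtrans_inject[OF g fx X Y] by simp
  next
    assume "X = Y"
    then have "tderiv P ?N snd (x, f x \<otimes> g) ?A = tderiv P ?N snd (x, f x \<otimes> g) ?B"
      unfolding lhs rhs by simp
    moreover have "tderiv P M fst (x, f x \<otimes> g) ?A = tderiv P M fst (x, f x \<otimes> g) ?B"
      unfolding d\<Phi>(2)[OF I1(1)] I1(2) I2(2) ..
    ultimately show "?A = ?B"
      using tangent_prod_eqI[OF M N _ d\<Phi>(1)[OF I1(1), unfolded P_def] I2(1)[unfolded P_def]] \<Phi>p
      by (simp add: P_def)
  qed
  also have "X = Y \<longleftrightarrow> ltrans G (inv (f x)) (f x) X = ltrans G (inv (f x)) (f x) Y"
    using ltrans_ltrans_inv[OF fx X] ltrans_ltrans_inv[OF fx Y] by metis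
  also have "ltrans G (inv (f x)) (f x) X = left_log_deriv M G f x (\<i> *\<^sub>C v) + (2 * \<i>) *\<^sub>C \<xi>1"
    using ltrans_add[OF inv_closed[OF fx] fx div tangent_2i[OF N l1]]
      ltrans_2i[OF inv_closed[OF fx] fx l1 l1] ltrans_inv_ltrans[OF fx \<xi>1]
    by (simp add: X_def left_log_deriv_def)
  also have "ltrans G (inv (f x)) (f x) Y = \<i> *\<^sub>C left_log_deriv M G f x v +
      (2 * \<i>) *\<^sub>C Ad_inv_form G f \<omega>2 x v"
    using ltrans_add[OF inv_closed[OF fx] fx tangent_i[OF N dv] tangent_2i[OF N r2]]
      ltrans_i[OF inv_closed[OF fx] fx dv dv] ltrans_2i[OF inv_closed[OF fx] fx r2 r2]
      inv_into_Ad[OF fx \<xi>2]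
    by (simp add: Y_def left_log_deriv_def Ad_inv_form_def \<xi>2_def)
  finally show ?thesis
    unfolding solve_for_type01_component \<Phi>p(1) left_log_dbar_def part01_def \<xi>1_def .
qed

lemma form_bundle_simps [simp]:
  "total (form_bundle M G \<omega>) = prod_mfd M (mfd G)"
  "cstruct (form_bundle M G \<omega>) = I_form M G \<omega>"
  "proj (form_bundle M G \<omega>) = fst"
  "act (form_bundle M G \<omega>) p g = (fst p, snd p \<otimes> g)"
  by (simp_all add: form_bundle_def)

text \<open>The equation for \<open>v\<close> at \<open>x\<close> is tested on the tangent vector \<open>(v, 0)\<close> at \<open>(x, 1)\<close>; conversely it
gives the intertwining relation at every point over \<open>x\<close>.\<close>

lemma gauge_bundle_holo_iff:
  fixes M :: "('a, 'm::complex_fd_space) manifold"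
  assumes M: "complex_manifold M" and \<omega>1: "\<omega>1 \<in> Omega01 M G" and \<omega>2: "\<omega>2 \<in> Omega01 M G"
    and f: "smooth_map M (mfd G) f"
  shows "bundle_holo (form_bundle M G \<omega>1) (form_bundle M G \<omega>2) (\<lambda>p. (fst p, f (fst p) \<otimes> snd p)) \<longleftrightarrow>
    (\<forall>x\<in>points M. \<forall>v\<in>tangent M x.
      \<omega>1 x v = left_log_dbar M G f x v + Ad_inv_form G f \<omega>2 x v)" (is "?holo \<longleftrightarrow> ?eq")
proof
  let ?P = "prod_mfd M (mfd G)" and ?\<Phi> = "\<lambda>p. (fst p, f (fst p) \<otimes> snd p)"
  note iff = gauge_intertwines_iff[OF M \<omega>1 \<omega>2 f]
  show ?eq if ?holo
  proof (intro ballI)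
    fix x v assume x: "x \<in> points M" and v: "v \<in> tangent M x"
    let ?t = "tpair M (mfd G) (x, \<one>) v 0"
    have one: "\<one> \<in> points (mfd G)" by (simp add: points_lie_group)
    note t = tpair_in_tangent[OF M mfd_lie_group x one v tangent_0[OF mfd_lie_group]]
    have "(x, \<one>) \<in> points ?P" using x one by simp
    then have "tderiv ?P ?P ?\<Phi> (x, \<one>) (I_form M G \<omega>1 (x, \<one>) ?t) =
        I_form M G \<omega>2 (?\<Phi> (x, \<one>)) (tderiv ?P ?P ?\<Phi> (x, \<one>) ?t)"
      using that t unfolding bundle_holo_def form_bundle_simps by blast
    then show "\<omega>1 x v = left_log_dbar M G f x v + Ad_inv_form G f \<omega>2 x v"
      unfolding iff[OF x one_closed t]
        tderiv_fst_tpair[OF M mfd_lie_group x one v tangent_0[OF mfd_lie_group]] .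
  qed
  show ?holo if eq: ?eq
    unfolding bundle_holo_def form_bundle_simps
  proof (intro conjI ballI)
    show "smooth_map ?P ?P ?\<Phi>" by (rule smooth_map_gauge_pair[OF M f])
    fix p t assume p: "p \<in> points ?P" and t: "t \<in> tangent ?P p"
    obtain x g where p_eq: "p = (x, g)" by (cases p)
    then have x: "x \<in> points M" and g: "g \<in> carrier G" using p by (simp_all add: points_lie_group)
    have "tderiv ?P M fst (x, g) t \<in> tangent M x"
      using tderiv_in_tangent[OF complex_manifold_prod[OF M mfd_lie_group] M smooth_map_fst[OF M mfd_lie_group] p t]
      by (simp add: p_eq)
    then show "tderiv ?P ?P ?\<Phi> p (I_form M G \<omega>1 p t) = I_form M G \<omega>2 (?\<Phi> p) (tderiv ?P ?P ?\<Phi> p t)"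
      using iff[OF x g t[unfolded p_eq]] eq x unfolding p_eq by blast
  qed
qed

text \<open>The transformation given by \<open>f\<^sup>-\<^sup>1\<close> is a smooth inverse, so holomorphy of the inverse is automatic.\<close>

lemma gauge_bundle_biholo:
  fixes M :: "('a, 'm::complex_fd_space) manifold"
  assumes M: "complex_manifold M" and \<omega>1: "\<omega>1 \<in> Omega01 M G"
    and f: "smooth_map M (mfd G) f"
    and holo: "bundle_holo (form_bundle M G \<omega>1) (form_bundle M G \<omega>2) (\<lambda>p. (fst p, f (fst p) \<otimes> snd p))"
  shows "bundle_biholo (form_bundle M G \<omega>1) (form_bundle M G \<omega>2) (\<lambda>p. (fst p, f (fst p) \<otimes> snd p))"
proof -
  let ?P = "prod_mfd M (mfd G)" and ?\<Phi> = "\<lambda>p. (fst p, f (fst p) \<otimes> snd p)"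
    and ?\<Psi> = "\<lambda>p. (fst p, inv (f (fst p)) \<otimes> snd p)"
  have P: "complex_manifold ?P" by (rule complex_manifold_prod[OF M mfd_lie_group])
  have fx: "f x \<in> carrier G" if "x \<in> points M" for x
    using smooth_map_points[OF f that] by (simp add: points_lie_group)
  have \<Psi>: "smooth_map ?P ?P ?\<Psi>"
    by (rule smooth_map_gauge_pair[OF M smooth_map_m_inv[OF M f]])
  have \<Psi>\<Phi>: "?\<Psi> (?\<Phi> p) = p" and \<Phi>\<Psi>: "?\<Phi> (?\<Psi> p) = p"
    and \<Phi>p: "?\<Phi> p \<in> points ?P" and \<Psi>p: "?\<Psi> p \<in> points ?P" if "p \<in> points ?P" for p
    using that fx by (auto simp: points_lie_group m_assoc[symmetric])
  have bij: "bij_betw ?\<Phi> (points ?P) (points ?P)"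
    using \<Psi>\<Phi> \<Phi>\<Psi> \<Phi>p \<Psi>p by (intro bij_betw_byWitness[where f' = ?\<Psi>]) blast+
  have inv: "?\<Psi> p = inv_into (points ?P) ?\<Phi> p" if "p \<in> points ?P" for p
    using bij_betw_imp_inj_on[OF bij] \<Psi>p[OF that] \<Phi>\<Psi>[OF that] by (rule inv_into_f_eq[symmetric])
  have "bundle_holo (form_bundle M G \<omega>2) (form_bundle M G \<omega>1) ?\<Psi>"
  proof (rule bundle_holo_inverse[OF _ _ holo])
    fix p t assume "p \<in> points (total (form_bundle M G \<omega>1))" "t \<in> tangent (total (form_bundle M G \<omega>1)) p"
    then show "cstruct (form_bundle M G \<omega>1) p t \<in> tangent (total (form_bundle M G \<omega>1)) p"
      using I_form_tangent[OF M \<omega>1, of "fst p" "snd p" t] by (auto simp: points_lie_group)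
  qed (use P \<Psi> \<Psi>\<Phi> \<Phi>\<Psi> in \<open>simp_all only: form_bundle_simps\<close>)
  then have "bundle_holo (form_bundle M G \<omega>2) (form_bundle M G \<omega>1) (inv_into (points ?P) ?\<Phi>)"
    by (rule bundle_holo_cong[rotated 3]) (simp_all only: form_bundle_simps P inv)
  then show ?thesis
    using holo bij by (simp only: bundle_biholo_def form_bundle_simps)
qed

text \<open>An equivariant map over the identity is determined by its values on the section \<open>x \<mapsto> (x, 1)\<close>,
because \<open>(x, g) = (x, 1) g\<close>.\<close>

lemma holo_equivalent_imp_gauge:
  fixes M :: "('a, 'm::complex_fd_space) manifold"
  assumes M: "complex_manifold M"
    and "holo_equivalent G (form_bundle M G \<omega>1) (form_bundle M G \<omega>2)"
  obtains f where "smooth_map M (mfd G) f"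
    "bundle_holo (form_bundle M G \<omega>1) (form_bundle M G \<omega>2) (\<lambda>p. (fst p, f (fst p) \<otimes> snd p))"
proof -
  let ?P = "prod_mfd M (mfd G)"
  obtain \<Phi> where biholo: "bundle_biholo (form_bundle M G \<omega>1) (form_bundle M G \<omega>2) \<Phi>"
    and proj: "\<And>p. p \<in> points ?P \<Longrightarrow> fst (\<Phi> p) = fst p"
    and equiv: "\<And>p g. p \<in> points ?P \<Longrightarrow> g \<in> carrier G \<Longrightarrow>
      \<Phi> (fst p, snd p \<otimes> g) = (fst (\<Phi> p), snd (\<Phi> p) \<otimes> g)"
    using assms(2) unfolding holo_equivalent_def form_bundle_simps by blast
  have P: "complex_manifold ?P" by (rule complex_manifold_prod[OF M mfd_lie_group])
  have holo: "bundle_holo (form_bundle M G \<omega>1) (form_bundle M G \<omega>2) \<Phi>"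
    using biholo by (simp add: bundle_biholo_def)
  then have \<Phi>: "smooth_map ?P ?P \<Phi>" by (simp add: bundle_holo_def)
  define f where "f = (\<lambda>x. snd (\<Phi> (x, \<one>)))"
  have one: "\<one> \<in> points (mfd G)" by (simp add: points_lie_group)
  have "smooth_map M ?P (\<lambda>x. (x, \<one>))"
    by (intro smooth_map_Pair smooth_map_id smooth_map_const M mfd_lie_group one)
  then have "smooth_map M ?P (\<lambda>x. \<Phi> (x, \<one>))"
    by (rule smooth_map_compose[OF M P P _ \<Phi>])
  then have f: "smooth_map M (mfd G) f"
    unfolding f_def by (rule smooth_map_compose[OF M P mfd_lie_group _ smooth_map_snd[OF M mfd_lie_group]])
  have "\<Phi> p = (fst p, f (fst p) \<otimes> snd p)" if "p \<in> points ?P" for p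
    using that equiv[of "(fst p, \<one>)" "snd p"] proj[of "(fst p, \<one>)"]
    by (auto simp: points_lie_group f_def)
  then have "bundle_holo (form_bundle M G \<omega>1) (form_bundle M G \<omega>2) (\<lambda>p. (fst p, f (fst p) \<otimes> snd p))"
    by (intro bundle_holo_cong[OF _ _ _ holo]) (simp_all only: form_bundle_simps P)
  with f show thesis by (rule that)
qed

end

theorem theorem9:
  fixes M :: "('a, 'm::complex_fd_space) manifold"
    and G :: "('g, 'n::complex_fd_space) lie_group"
    and \<omega>1 \<omega>2 :: "('a, 'm, 'g, 'n) lie_form1"
  assumes "complex_manifold M"
    and "complex_lie_group G"
    and "\<omega>1 \<in> Omega01 M G" and "\<omega>2 \<in> Omega01 M G"
    and "integrable_form M G \<omega>1" and "integrable_form M G \<omega>2"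
  shows "holo_equivalent G (form_bundle M G \<omega>1) (form_bundle M G \<omega>2) \<longleftrightarrow>
    (\<exists>f. smooth_map M (mfd G) f \<and>
      (\<forall>x\<in>points M. \<forall>v\<in>tangent M x.
         \<omega>1 x v = left_log_dbar M G f x v + Ad_inv_form G f \<omega>2 x v))"
proof
  assume "holo_equivalent G (form_bundle M G \<omega>1) (form_bundle M G \<omega>2)"
  then obtain f where f: "smooth_map M (mfd G) f" and
    "bundle_holo (form_bundle M G \<omega>1) (form_bundle M G \<omega>2) (\<lambda>p. (fst p, f (fst p) \<otimes>\<^bsub>G\<^esub> snd p))"
    by (rule holo_equivalent_imp_gauge[OF assms(2,1)])
  then show "\<exists>f. smooth_map M (mfd G) f \<and> (\<forall>x\<in>points M. \<forall>v\<in>tangent M x.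
      \<omega>1 x v = left_log_dbar M G f x v + Ad_inv_form G f \<omega>2 x v)"
    using gauge_bundle_holo_iff[OF assms(2,1,3,4) f] by blast
next
  assume "\<exists>f. smooth_map M (mfd G) f \<and> (\<forall>x\<in>points M. \<forall>v\<in>tangent M x.
      \<omega>1 x v = left_log_dbar M G f x v + Ad_inv_form G f \<omega>2 x v)"
  then obtain f where f: "smooth_map M (mfd G) f" and
    eq: "\<forall>x\<in>points M. \<forall>v\<in>tangent M x. \<omega>1 x v = left_log_dbar M G f x v + Ad_inv_form G f \<omega>2 x v"
    by blast
  interpret group G using assms(2) by (simp add: complex_lie_group_def)
  let ?\<Phi> = "\<lambda>p. (fst p, f (fst p) \<otimes>\<^bsub>G\<^esub> snd p)"
  have "bundle_biholo (form_bundle M G \<omega>1) (form_bundle M G \<omega>2) ?\<Phi>"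
    using gauge_bundle_biholo[OF assms(2,1,3) f] gauge_bundle_holo_iff[OF assms(2,1,3,4) f] eq by blast
  moreover have "f x \<in> carrier G" if "x \<in> points M" for x
    using smooth_map_points[OF f that] points_lie_group[OF assms(2)] by simp
  ultimately show "holo_equivalent G (form_bundle M G \<omega>1) (form_bundle M G \<omega>2)"
    unfolding holo_equivalent_def form_bundle_simps[OF assms(2)]
    by (intro exI[of _ ?\<Phi>]) (auto simp: points_lie_group[OF assms(2)] m_assoc)
qed

end
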